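(* Let $m_1<\cdots<m_n$ be positive integers containing a generalized arithmetic sequence $m_{i_1}<\cdots<m_{i_l}=m_n$ with $l\ge 3$; that is, there exist indices $1\le i_1<\cdots<i_l=n$ and $h,d\in\mathbb{Z}^+$ such that $m_{i_j}=h\,m_{i_1}+(j-1)d$ for all $j\in\{2,\ldots,l\}$. If $h>1$ and $h\,m_{i_1}\notin\{m_1,\ldots,m_n\}$, then $K[\mathcal{C}]$ is not Cohen-Macaulay.
   Context: $K$ is an infinite field and $R=K[x_1,\ldots,x_{n+1}]$. For positive integers $m_1<\cdots<m_n$, the associated projective monomial curve $\mathcal{C}\subset\mathbb{P}^n_K$ is parametrically defined by $x_i=u^{m_i}v^{m_n-m_i}$ for $1\le i\le n$ and $x_{n+1}=v^{m_n}$. Its vanishing ideal $I(\mathcal{C})\subset R$ is the kernel of the $K$-algebra homomorphism $R\to K[u,v]$, $x_i\mapsto u^{m_i}v^{m_n-m_i}$ ($1\le i\le n$), $x_{n+1}\mapsto v^{m_n}$, and $K[\mathcal{C}]=R/I(\mathcal{C})$. *)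

theory Defs
  imports
    "HOL-Algebra.QuotRing"
    "HOL-Algebra.Ring_Divisibility"
    "HOL-Library.Poly_Mapping"
    "HOL-Library.Extended_Nat"
begin

section \<open>Cohen--Macaulay rings\<close>

text \<open>Localization at (the complement of) a prime ideal: classes of fractions \<open>a/s\<close>, where
  \<open>a/s = b/t\<close> iff \<open>w (a t - b s) = 0\<close> for some \<open>w\<close> outside the prime.\<close>

definition frac_rel :: "('a, 'm) ring_scheme \<Rightarrow> 'a set \<Rightarrow> (('a \<times> 'a) \<times> ('a \<times> 'a)) set" where
  "frac_rel R P = {((a, s), (b, t)) | a s b t.
     a \<in> carrier R \<and> b \<in> carrier R \<and> s \<in> carrier R - P \<and> t \<in> carrier R - P \<and>
     (\<exists>w \<in> carrier R - P. w \<otimes>\<^bsub>R\<^esub> (a \<otimes>\<^bsub>R\<^esub> t) = w \<otimes>\<^bsub>R\<^esub> (b \<otimes>\<^bsub>R\<^esub> s))}"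

definition localization :: "('a, 'm) ring_scheme \<Rightarrow> 'a set \<Rightarrow> ('a \<times> 'a) set ring" where
  "localization R P =
     \<lparr> carrier = (carrier R \<times> (carrier R - P)) // frac_rel R P,
       mult = (\<lambda>X Y. \<Union>(a, s)\<in>X. \<Union>(b, t)\<in>Y.
         frac_rel R P `` {(a \<otimes>\<^bsub>R\<^esub> b, s \<otimes>\<^bsub>R\<^esub> t)}),
       one = frac_rel R P `` {(\<one>\<^bsub>R\<^esub>, \<one>\<^bsub>R\<^esub>)},
       zero = frac_rel R P `` {(\<zero>\<^bsub>R\<^esub>, \<one>\<^bsub>R\<^esub>)},
       add = (\<lambda>X Y. \<Union>(a, s)\<in>X. \<Union>(b, t)\<in>Y.
         frac_rel R P `` {(a \<otimes>\<^bsub>R\<^esub> t \<oplus>\<^bsub>R\<^esub> b \<otimes>\<^bsub>R\<^esub> s, s \<otimes>\<^bsub>R\<^esub> t)}) \<rparr>"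

definition krull_dim :: "('a, 'm) ring_scheme \<Rightarrow> enat" where
  "krull_dim R = Sup {enat k | k Qs. length Qs = Suc k \<and>
     (\<forall>Q \<in> set Qs. primeideal Q R) \<and> sorted_wrt (\<subset>) Qs}"

text \<open>\<open>xs ! i\<close> is a non-zero-divisor modulo the ideal generated by its predecessors, and the
  whole sequence generates a proper ideal.\<close>

definition regular_sequence :: "('a, 'm) ring_scheme \<Rightarrow> 'a list \<Rightarrow> bool" where
  "regular_sequence R xs \<longleftrightarrow>
     set xs \<subseteq> carrier R \<and>
     (\<forall>i < length xs. \<forall>a \<in> carrier R.
        xs ! i \<otimes>\<^bsub>R\<^esub> a \<in> Idl\<^bsub>R\<^esub> (set (take i xs)) \<longrightarrow> a \<in> Idl\<^bsub>R\<^esub> (set (take i xs))) \<and>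
     Idl\<^bsub>R\<^esub> (set xs) \<noteq> carrier R"

text \<open>Intended for local rings, where \<open>M\<close> can only be the unique maximal ideal.\<close>

definition local_depth :: "('a, 'm) ring_scheme \<Rightarrow> enat" where
  "local_depth R = Sup {enat (length xs) | xs M.
     maximalideal M R \<and> set xs \<subseteq> M \<and> regular_sequence R xs}"

definition cohen_macaulay :: "('a, 'm) ring_scheme \<Rightarrow> bool" where
  "cohen_macaulay R \<longleftrightarrow> cring R \<and> noetherian_ring R \<and>
     (\<forall>M. maximalideal M R \<longrightarrow>
        local_depth (localization R M) = krull_dim (localization R M))"


section \<open>Polynomial rings\<close>

text \<open>A monomial is a finitely supported exponent vector, a polynomial a finitely supported
  family of coefficients. Multiplication on the type is convolution.\<close>

type_synonym ('v, 'k) mpol = "('v \<Rightarrow>\<^sub>0 nat) \<Rightarrow>\<^sub>0 'k"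

definition mpol_ring :: "'v set \<Rightarrow> ('v, 'k::comm_ring_1) mpol ring" where
  "mpol_ring V =
     \<lparr> carrier = {p. \<forall>t \<in> Poly_Mapping.keys p. Poly_Mapping.keys t \<subseteq> V},
       mult = (*), one = 1, zero = 0, add = (+) \<rparr>"

definition mpol_const :: "'k \<Rightarrow> ('v, 'k::comm_ring_1) mpol" where
  "mpol_const c = Poly_Mapping.single 0 c"

definition mpol_var :: "'v \<Rightarrow> ('v, 'k::comm_ring_1) mpol" where
  "mpol_var x = Poly_Mapping.single (Poly_Mapping.single x 1) 1"

text \<open>The algebra homomorphism sending each variable \<open>x\<close> to \<open>g x\<close>.\<close>

definition mpol_subst :: "('v \<Rightarrow> ('w, 'k) mpol) \<Rightarrow> ('v, 'k::comm_ring_1) mpol \<Rightarrow> ('w, 'k) mpol" where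
  "mpol_subst g p =
     (\<Sum>t \<in> Poly_Mapping.keys p. mpol_const (Poly_Mapping.lookup p t) * (\<Prod>x \<in> Poly_Mapping.keys t. g x ^ Poly_Mapping.lookup t x))"


section \<open>Projective monomial curves\<close>

text \<open>The parameters \<open>u\<close>, \<open>v\<close>; thus \<open>mpol_ring (UNIV :: param set)\<close> is \<open>K[u, v]\<close>.\<close>

datatype param = Param_u | Param_v

text \<open>Natural subtraction does not truncate here when \<open>m\<close> is monotone on \<open>{1..n}\<close>.
  The value at \<open>i \<notin> {1..n + 1}\<close> is irrelevant.\<close>

definition monomial_param :: "nat \<Rightarrow> (nat \<Rightarrow> nat) \<Rightarrow> nat \<Rightarrow> (param, 'k::comm_ring_1) mpol" where
  "monomial_param n m i =
     (if i = n + 1 then mpol_var Param_v ^ m n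
      else mpol_var Param_u ^ m i * mpol_var Param_v ^ (m n - m i))"

definition vanishing_ideal :: "nat \<Rightarrow> (nat \<Rightarrow> nat) \<Rightarrow> (nat, 'k::comm_ring_1) mpol set" where
  "vanishing_ideal n m =
     a_kernel (mpol_ring {1..n + 1}) (mpol_ring UNIV) (mpol_subst (monomial_param n m))"

definition coordinate_ring :: "nat \<Rightarrow> (nat \<Rightarrow> nat) \<Rightarrow> (nat, 'k::comm_ring_1) mpol set ring" where
  "coordinate_ring n m = mpol_ring {1..n + 1} Quot vanishing_ideal n m"


section \<open>Well-definedness\<close>

lemma prime_complement:
  fixes R (structure)
  assumes "primeideal P R"
  shows "\<one>\<^bsub>R\<^esub> \<in> carrier R - P"
    and "\<lbrakk>s \<in> carrier R - P; t \<in> carrier R - P\<rbrakk> \<Longrightarrow> s \<otimes>\<^bsub>R\<^esub> t \<in> carrier R - P"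
proof -
  interpret primeideal P R by fact
  show "\<one>\<^bsub>R\<^esub> \<in> carrier R - P"
    using I_notcarr one_imp_carrier by blast
  show "\<lbrakk>s \<in> carrier R - P; t \<in> carrier R - P\<rbrakk> \<Longrightarrow> s \<otimes>\<^bsub>R\<^esub> t \<in> carrier R - P"
    using I_prime by blast
qed

lemma frac_rel_iff:
  "((a, s), (b, t)) \<in> frac_rel R P \<longleftrightarrow>
     a \<in> carrier R \<and> b \<in> carrier R \<and> s \<in> carrier R - P \<and> t \<in> carrier R - P \<and>
     (\<exists>w \<in> carrier R - P. w \<otimes>\<^bsub>R\<^esub> (a \<otimes>\<^bsub>R\<^esub> t) = w \<otimes>\<^bsub>R\<^esub> (b \<otimes>\<^bsub>R\<^esub> s))"
  by (simp add: frac_rel_def)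

lemma equiv_frac_rel:
  fixes R (structure)
  assumes "primeideal P R"
  shows "equiv (carrier R \<times> (carrier R - P)) (frac_rel R P)"
proof (rule equivI)
  interpret primeideal P R by fact
  note mult_closed = prime_complement(2)[OF assms]
  show "frac_rel R P \<subseteq> (carrier R \<times> (carrier R - P)) \<times> (carrier R \<times> (carrier R - P))"
    by (auto simp: frac_rel_def)
  show "refl_on (carrier R \<times> (carrier R - P)) (frac_rel R P)"
    using prime_complement(1)[OF assms] by (auto simp: refl_on_def frac_rel_iff)
  show "sym (frac_rel R P)"
    by (rule symI) (auto simp: frac_rel_def; metis DiffI)
  show "trans (frac_rel R P)"
  proof (rule transI, clarify)
    fix a s b t c u
    assume "((a, s), (b, t)) \<in> frac_rel R P" "((b, t), (c, u)) \<in> frac_rel R P"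
    then obtain w w' where
      c: "a \<in> carrier R" "b \<in> carrier R" "c \<in> carrier R"
        "s \<in> carrier R - P" "t \<in> carrier R - P" "u \<in> carrier R - P"
        "w \<in> carrier R - P" "w' \<in> carrier R - P" and
      e: "w \<otimes> (a \<otimes> t) = w \<otimes> (b \<otimes> s)" "w' \<otimes> (b \<otimes> u) = w' \<otimes> (c \<otimes> t)"
      unfolding frac_rel_iff by blast
    have c': "s \<in> carrier R" "t \<in> carrier R" "u \<in> carrier R" "w \<in> carrier R" "w' \<in> carrier R"
      using c by auto
    have "((w \<otimes> w') \<otimes> t) \<otimes> (a \<otimes> u) = (w \<otimes> (a \<otimes> t)) \<otimes> (w' \<otimes> u)"
      using c c' by (simp add: m_ac)
    also have "\<dots> = (w' \<otimes> (b \<otimes> u)) \<otimes> (w \<otimes> s)"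
      unfolding e(1) using c c' by (simp add: m_ac)
    also have "\<dots> = ((w \<otimes> w') \<otimes> t) \<otimes> (c \<otimes> s)"
      unfolding e(2) using c c' by (simp add: m_ac)
    finally show "((a, s), (c, u)) \<in> frac_rel R P"
      unfolding frac_rel_iff using c mult_closed by blast
  qed
qed

lemma frac_mult_congruent:
  fixes R (structure)
  assumes "primeideal P R"
  shows "congruent2 (frac_rel R P) (frac_rel R P) (\<lambda>x y.
    (\<lambda>(a, s). (\<lambda>(b, t). frac_rel R P `` {(a \<otimes>\<^bsub>R\<^esub> b, s \<otimes>\<^bsub>R\<^esub> t)}) y) x)"
proof (rule congruent2I', clarsimp)
  interpret primeideal P R by fact
  note mult_closed = prime_complement(2)[OF assms]
  fix a s a' s' b t b' t'
  assume "((a, s), (a', s')) \<in> frac_rel R P" "((b, t), (b', t')) \<in> frac_rel R P"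
  then obtain w w' where
    c: "a \<in> carrier R" "b \<in> carrier R" "a' \<in> carrier R" "b' \<in> carrier R"
      "s \<in> carrier R - P" "t \<in> carrier R - P" "s' \<in> carrier R - P" "t' \<in> carrier R - P"
      "w \<in> carrier R - P" "w' \<in> carrier R - P" and
    e: "w \<otimes> (a \<otimes> s') = w \<otimes> (a' \<otimes> s)" "w' \<otimes> (b \<otimes> t') = w' \<otimes> (b' \<otimes> t)"
    unfolding frac_rel_iff by blast
  have c': "s \<in> carrier R" "t \<in> carrier R" "s' \<in> carrier R" "t' \<in> carrier R"
    "w \<in> carrier R" "w' \<in> carrier R" using c by auto
  have "(w \<otimes> w') \<otimes> ((a \<otimes> b) \<otimes> (s' \<otimes> t')) = (w \<otimes> (a \<otimes> s')) \<otimes> (w' \<otimes> (b \<otimes> t'))"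
    using c c' by (simp add: m_ac)
  also have "\<dots> = (w \<otimes> w') \<otimes> ((a' \<otimes> b') \<otimes> (s \<otimes> t))"
    unfolding e using c c' by (simp add: m_ac)
  finally have "((a \<otimes> b, s \<otimes> t), (a' \<otimes> b', s' \<otimes> t')) \<in> frac_rel R P"
    unfolding frac_rel_iff using c mult_closed by blast
  then show "frac_rel R P `` {(a \<otimes> b, s \<otimes> t)} = frac_rel R P `` {(a' \<otimes> b', s' \<otimes> t')}"
    by (rule equiv_class_eq[OF equiv_frac_rel[OF assms]])
qed

lemma frac_add_congruent:
  fixes R (structure)
  assumes "primeideal P R"
  shows "congruent2 (frac_rel R P) (frac_rel R P) (\<lambda>x y. (\<lambda>(a, s). (\<lambda>(b, t).
    frac_rel R P `` {(a \<otimes>\<^bsub>R\<^esub> t \<oplus>\<^bsub>R\<^esub> b \<otimes>\<^bsub>R\<^esub> s, s \<otimes>\<^bsub>R\<^esub> t)}) y) x)"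
proof (rule congruent2I', clarsimp)
  interpret primeideal P R by fact
  note mult_closed = prime_complement(2)[OF assms]
  fix a s a' s' b t b' t'
  assume "((a, s), (a', s')) \<in> frac_rel R P" "((b, t), (b', t')) \<in> frac_rel R P"
  then obtain w w' where
    c: "a \<in> carrier R" "b \<in> carrier R" "a' \<in> carrier R" "b' \<in> carrier R"
      "s \<in> carrier R - P" "t \<in> carrier R - P" "s' \<in> carrier R - P" "t' \<in> carrier R - P"
      "w \<in> carrier R - P" "w' \<in> carrier R - P" and
    e: "w \<otimes> (a \<otimes> s') = w \<otimes> (a' \<otimes> s)" "w' \<otimes> (b \<otimes> t') = w' \<otimes> (b' \<otimes> t)"
    unfolding frac_rel_iff by blast
  have c': "s \<in> carrier R" "t \<in> carrier R" "s' \<in> carrier R" "t' \<in> carrier R"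
    "w \<in> carrier R" "w' \<in> carrier R" using c by auto
  have "(w \<otimes> w') \<otimes> ((a \<otimes> t \<oplus> b \<otimes> s) \<otimes> (s' \<otimes> t')) =
      (w \<otimes> (a \<otimes> s')) \<otimes> (w' \<otimes> (t \<otimes> t')) \<oplus> (w' \<otimes> (b \<otimes> t')) \<otimes> (w \<otimes> (s \<otimes> s'))"
    using c c' by (simp add: m_ac l_distr r_distr)
  also have "\<dots> = (w \<otimes> w') \<otimes> ((a' \<otimes> t' \<oplus> b' \<otimes> s') \<otimes> (s \<otimes> t))"
    unfolding e using c c' by (simp add: m_ac l_distr r_distr)
  finally have "((a \<otimes> t \<oplus> b \<otimes> s, s \<otimes> t), (a' \<otimes> t' \<oplus> b' \<otimes> s', s' \<otimes> t')) \<in> frac_rel R P"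
    unfolding frac_rel_iff using c c' mult_closed by blast
  then show "frac_rel R P `` {(a \<otimes> t \<oplus> b \<otimes> s, s \<otimes> t)} =
      frac_rel R P `` {(a' \<otimes> t' \<oplus> b' \<otimes> s', s' \<otimes> t')}"
    by (rule equiv_class_eq[OF equiv_frac_rel[OF assms]])
qed

lemma localization_simps:
  fixes R (structure)
  assumes "primeideal P R"
    and "a \<in> carrier R" "b \<in> carrier R" "s \<in> carrier R - P" "t \<in> carrier R - P"
  shows "frac_rel R P `` {(a, s)} \<otimes>\<^bsub>localization R P\<^esub> frac_rel R P `` {(b, t)} =
      frac_rel R P `` {(a \<otimes>\<^bsub>R\<^esub> b, s \<otimes>\<^bsub>R\<^esub> t)}"
    and "frac_rel R P `` {(a, s)} \<oplus>\<^bsub>localization R P\<^esub> frac_rel R P `` {(b, t)} =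
      frac_rel R P `` {(a \<otimes>\<^bsub>R\<^esub> t \<oplus>\<^bsub>R\<^esub> b \<otimes>\<^bsub>R\<^esub> s, s \<otimes>\<^bsub>R\<^esub> t)}"
  using UN_equiv_class2[OF equiv_frac_rel[OF assms(1)] equiv_frac_rel[OF assms(1)]
      frac_mult_congruent[OF assms(1)], of "(a, s)" "(b, t)"]
    UN_equiv_class2[OF equiv_frac_rel[OF assms(1)] equiv_frac_rel[OF assms(1)]
      frac_add_congruent[OF assms(1)], of "(a, s)" "(b, t)"] assms(2-)
  by (simp_all add: localization_def case_prod_unfold)

lemma localization_carrier_cases:
  assumes "X \<in> carrier (localization R P)"
  obtains a s where "a \<in> carrier R" "s \<in> carrier R - P" "X = frac_rel R P `` {(a, s)}"
  using assms by (auto simp: localization_def elim!: quotientE)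

lemma localization_carrierI:
  "\<lbrakk>a \<in> carrier R; s \<in> carrier R - P\<rbrakk> \<Longrightarrow> frac_rel R P `` {(a, s)} \<in> carrier (localization R P)"
  by (auto simp: localization_def intro!: quotientI)

lemma frac_eqI:
  fixes R (structure)
  assumes "primeideal P R" "a \<in> carrier R" "b \<in> carrier R" "s \<in> carrier R - P" "t \<in> carrier R - P"
    and "a \<otimes>\<^bsub>R\<^esub> t = b \<otimes>\<^bsub>R\<^esub> s"
  shows "frac_rel R P `` {(a, s)} = frac_rel R P `` {(b, t)}"
  by (rule equiv_class_eq[OF equiv_frac_rel[OF assms(1)]])
     (use assms prime_complement(1)[OF assms(1)] in \<open>auto simp: frac_rel_iff\<close>)

lemma cring_localization:
  fixes R (structure)
  assumes "primeideal P R"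
  shows "cring (localization R P)"
proof -
  interpret primeideal P R by fact
  note S = prime_complement[OF assms]
  note [simp] = localization_simps[OF assms]
  note [intro] = localization_carrierI
  note eqI = frac_eqI[OF assms]
  have S' [simp]: "s \<in> carrier R" if "s \<in> carrier R - P" for s using that by simp
  have one: "\<one>\<^bsub>localization R P\<^esub> = frac_rel R P `` {(\<one>, \<one>)}"
    and zero: "\<zero>\<^bsub>localization R P\<^esub> = frac_rel R P `` {(\<zero>, \<one>)}"
    by (simp_all add: localization_def)
  show ?thesis
  proof (rule cringI)
    show "abelian_group (localization R P)"
    proof (rule abelian_groupI)
      fix X Y assume "X \<in> carrier (localization R P)" "Y \<in> carrier (localization R P)"
      then show "X \<oplus>\<^bsub>localization R P\<^esub> Y \<in> carrier (localization R P)"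
        by (elim localization_carrier_cases)
           (simp del: Diff_iff add: S localization_carrierI)
    next
      show "\<zero>\<^bsub>localization R P\<^esub> \<in> carrier (localization R P)"
        unfolding zero by (rule localization_carrierI) (use S in auto)
    next
      fix X Y Z assume "X \<in> carrier (localization R P)" "Y \<in> carrier (localization R P)"
        "Z \<in> carrier (localization R P)"
      then show "X \<oplus>\<^bsub>localization R P\<^esub> Y \<oplus>\<^bsub>localization R P\<^esub> Z =
          X \<oplus>\<^bsub>localization R P\<^esub> (Y \<oplus>\<^bsub>localization R P\<^esub> Z)"
        by (elim localization_carrier_cases)
           (simp del: Diff_iff add: S m_ac a_ac l_distr r_distr)
    next
      fix X Y assume "X \<in> carrier (localization R P)" "Y \<in> carrier (localization R P)"
      then show "X \<oplus>\<^bsub>localization R P\<^esub> Y = Y \<oplus>\<^bsub>localization R P\<^esub> X"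
        by (elim localization_carrier_cases)
           (simp del: Diff_iff add: S m_ac a_ac l_distr r_distr)
    next
      fix X assume "X \<in> carrier (localization R P)"
      then show "\<zero>\<^bsub>localization R P\<^esub> \<oplus>\<^bsub>localization R P\<^esub> X = X"
        unfolding zero by (elim localization_carrier_cases) (simp del: Diff_iff add: S)
    next
      fix X assume "X \<in> carrier (localization R P)"
      then obtain a s where X: "a \<in> carrier R" "s \<in> carrier R - P" "X = frac_rel R P `` {(a, s)}"
        by (rule localization_carrier_cases)
      show "\<exists>Y \<in> carrier (localization R P).
          Y \<oplus>\<^bsub>localization R P\<^esub> X = \<zero>\<^bsub>localization R P\<^esub>"
      proof (rule bexI)
        have "\<ominus> a \<otimes> s \<oplus> a \<otimes> s = \<zero>"
          using X by (simp add: l_minus l_neg)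
        then show "frac_rel R P `` {(\<ominus> a, s)} \<oplus>\<^bsub>localization R P\<^esub> X =
            \<zero>\<^bsub>localization R P\<^esub>"
          unfolding zero using X S by (simp del: Diff_iff) (rule eqI; simp del: Diff_iff add: S)
      qed (use X in auto)
    qed
    show "comm_monoid (localization R P)"
    proof (rule comm_monoidI)
      fix X Y assume "X \<in> carrier (localization R P)" "Y \<in> carrier (localization R P)"
      then show "X \<otimes>\<^bsub>localization R P\<^esub> Y \<in> carrier (localization R P)"
        by (elim localization_carrier_cases)
           (simp del: Diff_iff add: S localization_carrierI)
    next
      show "\<one>\<^bsub>localization R P\<^esub> \<in> carrier (localization R P)"
        unfolding one by (rule localization_carrierI) (use S in auto)
    next
      fix X Y Z assume "X \<in> carrier (localization R P)" "Y \<in> carrier (localization R P)"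
        "Z \<in> carrier (localization R P)"
      then show "X \<otimes>\<^bsub>localization R P\<^esub> Y \<otimes>\<^bsub>localization R P\<^esub> Z =
          X \<otimes>\<^bsub>localization R P\<^esub> (Y \<otimes>\<^bsub>localization R P\<^esub> Z)"
        by (elim localization_carrier_cases) (simp del: Diff_iff add: S m_ac)
    next
      fix X assume "X \<in> carrier (localization R P)"
      then show "\<one>\<^bsub>localization R P\<^esub> \<otimes>\<^bsub>localization R P\<^esub> X = X"
        unfolding one by (elim localization_carrier_cases) (simp del: Diff_iff add: S)
    next
      fix X Y assume "X \<in> carrier (localization R P)" "Y \<in> carrier (localization R P)"
      then show "X \<otimes>\<^bsub>localization R P\<^esub> Y = Y \<otimes>\<^bsub>localization R P\<^esub> X"
        by (elim localization_carrier_cases) (simp del: Diff_iff add: S m_ac)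
    qed
  next
    fix X Y Z assume "X \<in> carrier (localization R P)" "Y \<in> carrier (localization R P)"
      "Z \<in> carrier (localization R P)"
    then show "(X \<oplus>\<^bsub>localization R P\<^esub> Y) \<otimes>\<^bsub>localization R P\<^esub> Z =
        X \<otimes>\<^bsub>localization R P\<^esub> Z \<oplus>\<^bsub>localization R P\<^esub> Y \<otimes>\<^bsub>localization R P\<^esub> Z"
      by (elim localization_carrier_cases)
         (simp del: Diff_iff add: S, rule eqI; simp del: Diff_iff add: S m_ac l_distr r_distr)
  qed
qed

lemma cring_mpol_ring: "cring (mpol_ring V :: ('v, 'k::comm_ring_1) mpol ring)"
proof -
  have mult: "p * q \<in> carrier (mpol_ring V)"
    if "p \<in> carrier (mpol_ring V)" "q \<in> carrier (mpol_ring V)"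
    for p q :: "('v, 'k) mpol"
  proof -
    have "Poly_Mapping.keys t \<subseteq> V" if t: "t \<in> Poly_Mapping.keys (p * q)" for t
    proof -
      obtain a b where "t = a + b" "a \<in> Poly_Mapping.keys p" "b \<in> Poly_Mapping.keys q"
        using t keys_mult[of p q] by blast
      then show ?thesis
        using Poly_Mapping.keys_add[of a b] \<open>p \<in> _\<close> \<open>q \<in> _\<close>
        by (fastforce simp: mpol_ring_def)
    qed
    then show ?thesis by (simp add: mpol_ring_def)
  qed
  have add: "p + q \<in> carrier (mpol_ring V)"
    if "p \<in> carrier (mpol_ring V)" "q \<in> carrier (mpol_ring V)"
    for p q :: "('v, 'k) mpol"
    using that Poly_Mapping.keys_add[of p q] by (fastforce simp: mpol_ring_def)
  have uminus: "- p \<in> carrier (mpol_ring V)" if "p \<in> carrier (mpol_ring V)"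
    for p :: "('v, 'k) mpol"
    using that by (auto simp: mpol_ring_def in_keys_iff)
  have zero: "0 \<in> carrier (mpol_ring V)" and one: "1 \<in> carrier (mpol_ring V)"
    by (auto simp: mpol_ring_def)
  have ops: "p \<oplus>\<^bsub>mpol_ring V\<^esub> q = p + q" "p \<otimes>\<^bsub>mpol_ring V\<^esub> q = p * q"
    "\<zero>\<^bsub>mpol_ring V\<^esub> = 0" "\<one>\<^bsub>mpol_ring V\<^esub> = 1" for p q :: "('v, 'k) mpol"
    by (simp_all add: mpol_ring_def)
  show ?thesis
  proof (rule cringI)
    show "abelian_group (mpol_ring V :: ('v, 'k) mpol ring)"
    proof (rule abelian_groupI)
      fix p :: "('v, 'k) mpol" assume p: "p \<in> carrier (mpol_ring V)"
      show "\<exists>q\<in>carrier (mpol_ring V). q \<oplus>\<^bsub>mpol_ring V\<^esub> p = \<zero>\<^bsub>mpol_ring V\<^esub>"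
        using uminus[OF p] by (rule bexI[rotated]) (simp add: mpol_ring_def)
    qed (auto simp: ops add zero add.assoc add.commute)
    show "comm_monoid (mpol_ring V :: ('v, 'k) mpol ring)"
      by (rule comm_monoidI) (auto simp: ops mult one mult.assoc mult.commute)
  qed (simp add: ops distrib_right)
qed

lemma mpol_subst_superset:
  assumes "finite T" "Poly_Mapping.keys p \<subseteq> T"
  shows "mpol_subst g p =
    (\<Sum>t \<in> T. mpol_const (Poly_Mapping.lookup p t) * (\<Prod>x \<in> Poly_Mapping.keys t. g x ^ Poly_Mapping.lookup t x))"
  unfolding mpol_subst_def
  by (rule sum.mono_neutral_left) (use assms in \<open>auto simp: in_keys_iff mpol_const_def\<close>)

lemma mpol_subst_add: "mpol_subst g (p + q) = mpol_subst g p + mpol_subst g q"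
proof -
  let ?T = "Poly_Mapping.keys p \<union> Poly_Mapping.keys q"
  have "Poly_Mapping.keys (p + q) \<subseteq> ?T" by (rule Poly_Mapping.keys_add)
  then show ?thesis
    by (simp add: mpol_subst_superset[of ?T] mpol_const_def lookup_add single_add
        distrib_right sum.distrib)
qed

lemma mpol_subst_zero [simp]: "mpol_subst g 0 = 0"
  by (simp add: mpol_subst_def)

lemma mpol_subst_sum: "mpol_subst g (sum f A) = (\<Sum>x\<in>A. mpol_subst g (f x))"
  by (induction A rule: infinite_finite_induct) (auto simp: mpol_subst_add)

lemma mpol_subst_single:
  "mpol_subst g (Poly_Mapping.single t c) =
    mpol_const c * (\<Prod>x \<in> Poly_Mapping.keys t. g x ^ Poly_Mapping.lookup t x)"
  by (cases "c = 0") (auto simp: mpol_subst_def mpol_const_def)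

lemma mpol_subst_const: "mpol_subst g (mpol_const c) = mpol_const c"
  by (simp add: mpol_subst_single mpol_const_def)

lemma mpol_subst_var: "mpol_subst g (mpol_var x) = g x"
  unfolding mpol_var_def mpol_subst_single by (simp add: mpol_const_def)

lemma monomial_subst_add:
  fixes g :: "'v \<Rightarrow> 'a::comm_ring_1"
  shows "(\<Prod>x \<in> Poly_Mapping.keys (s + t). g x ^ Poly_Mapping.lookup (s + t) x) =
    (\<Prod>x \<in> Poly_Mapping.keys s. g x ^ Poly_Mapping.lookup s x) * (\<Prod>x \<in> Poly_Mapping.keys t. g x ^ Poly_Mapping.lookup t x)"
proof -
  let ?T = "Poly_Mapping.keys s \<union> Poly_Mapping.keys t"
  have *: "(\<Prod>x \<in> Poly_Mapping.keys r. g x ^ Poly_Mapping.lookup r x) = (\<Prod>x \<in> ?T. g x ^ Poly_Mapping.lookup r x)"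
    if "Poly_Mapping.keys r \<subseteq> ?T" for r
    by (rule prod.mono_neutral_left) (use that in \<open>auto simp: in_keys_iff\<close>)
  show ?thesis
    using *[OF Poly_Mapping.keys_add] *[of s] *[of t]
    by (simp add: lookup_add power_add prod.distrib)
qed

lemma mpol_sum_single: "p = (\<Sum>t \<in> Poly_Mapping.keys p. Poly_Mapping.single t (Poly_Mapping.lookup p t))"
proof (rule poly_mapping_eqI)
  fix k
  show "Poly_Mapping.lookup p k = Poly_Mapping.lookup (\<Sum>t \<in> Poly_Mapping.keys p. Poly_Mapping.single t (Poly_Mapping.lookup p t)) k"
    by (cases "k \<in> Poly_Mapping.keys p") (auto simp: lookup_sum lookup_single when_def in_keys_iff)
qed

lemma mpol_subst_mult: "mpol_subst g (p * q) = mpol_subst g p * mpol_subst g q"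
proof -
  have const: "mpol_const (a * b) = (mpol_const a * mpol_const b :: ('x, 'y::comm_ring_1) mpol)"
    for a b by (simp add: mpol_const_def mult_single)
  have "p * q = (\<Sum>s \<in> Poly_Mapping.keys p. \<Sum>t \<in> Poly_Mapping.keys q.
      Poly_Mapping.single (s + t) (Poly_Mapping.lookup p s * Poly_Mapping.lookup q t))"
    by (subst mpol_sum_single[of p], subst mpol_sum_single[of q])
       (simp add: sum_product mult_single)
  then have "mpol_subst g (p * q) = (\<Sum>s \<in> Poly_Mapping.keys p. \<Sum>t \<in> Poly_Mapping.keys q.
      mpol_const (Poly_Mapping.lookup p s * Poly_Mapping.lookup q t) * (\<Prod>x \<in> Poly_Mapping.keys (s + t). g x ^ Poly_Mapping.lookup (s + t) x))"
    by (simp add: mpol_subst_sum mpol_subst_single)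
  also have "\<dots> = (\<Sum>s \<in> Poly_Mapping.keys p. \<Sum>t \<in> Poly_Mapping.keys q.
      (mpol_const (Poly_Mapping.lookup p s) * (\<Prod>x \<in> Poly_Mapping.keys s. g x ^ Poly_Mapping.lookup s x)) *
      (mpol_const (Poly_Mapping.lookup q t) * (\<Prod>x \<in> Poly_Mapping.keys t. g x ^ Poly_Mapping.lookup t x)))"
    by (intro sum.cong refl) (simp add: monomial_subst_add const mult_ac)
  also have "\<dots> = mpol_subst g p * mpol_subst g q"
    by (simp add: mpol_subst_def sum_product)
  finally show ?thesis .
qed

lemma mpol_subst_ring_hom_ring:
  "ring_hom_ring (mpol_ring V) (mpol_ring UNIV) (mpol_subst g)"
proof (rule ring_hom_ringI2)
  have "mpol_subst g 1 = 1"
    using mpol_subst_const[of g 1] by (simp add: mpol_const_def)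
  then show "mpol_subst g \<in> ring_hom (mpol_ring V) (mpol_ring UNIV)"
    by (intro ring_hom_memI) (auto simp: mpol_ring_def mpol_subst_add mpol_subst_mult)
qed (intro cring.axioms cring_mpol_ring)+

lemma ideal_vanishing_ideal: "ideal (vanishing_ideal n m) (mpol_ring {1..n + 1})"
  unfolding vanishing_ideal_def
  by (rule ring_hom_ring.kernel_is_ideal[OF mpol_subst_ring_hom_ring])

lemma cring_coordinate_ring: "cring (coordinate_ring n m)"
  unfolding coordinate_ring_def
  by (rule ideal.quotient_is_cring[OF ideal_vanishing_ideal cring_mpol_ring])

end

theory Submission
  imports Defs
begin

text \<open>Write \<open>S \<subseteq> \<nat>\<^sup>2\<close> for the semigroup generated by the exponents \<open>a\<^sub>j\<close> of the parametrization, so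
  that \<open>K[C]\<close> is the semigroup ring \<open>K[S]\<close>. The exponent \<open>s\<^sub>0\<close> of degree one with \<open>u\<close>-part
  \<open>h m\<^bsub>i\<^sub>1\<^esub>\<close> is missing from \<open>S\<close>, whereas \<open>s\<^sub>0 + a\<^sub>n = a\<^bsub>i\<^sub>2\<^esub> + a\<^bsub>i\<^sub>l\<^sub>-\<^sub>1\<^esub>\<close> and
  \<open>s\<^sub>0 + (h - 1) a\<^sub>n\<^sub>+\<^sub>1 = h a\<^bsub>i\<^sub>1\<^esub>\<close> lie in \<open>S\<close>. Adding generators as long as one stays outside \<open>S\<close>
  leads from \<open>s\<^sub>0\<close> to some \<open>s \<notin> S\<close> with \<open>s + a\<^sub>j \<in> S\<close> for all \<open>j\<close>. Then the ideal \<open>M\<close> of the vertex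
  is the annihilator of the class of \<open>x\<^bsup>s + a\<^sub>n\<^esup>\<close> modulo \<open>x\<^bsup>a\<^sub>n\<^esup>\<close>, which makes the depth at \<open>M\<close> at
  most one, while the dimension is at least two.\<close>

section \<open>Localizations of domains\<close>

lemma localization_consts:
  "\<one>\<^bsub>localization R P\<^esub> = frac_rel R P `` {(\<one>\<^bsub>R\<^esub>, \<one>\<^bsub>R\<^esub>)}"
  "\<zero>\<^bsub>localization R P\<^esub> = frac_rel R P `` {(\<zero>\<^bsub>R\<^esub>, \<one>\<^bsub>R\<^esub>)}"
  by (simp_all add: localization_def)

text \<open>The base ring is a domain so that fractions can be compared by plain cross
  multiplication.\<close>

locale domain_with_prime = domain R for R (structure) +
  fixes M
  assumes prime_M: "primeideal M R"
begin

abbreviation Loc where "Loc \<equiv> localization R M"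
abbreviation frac where "frac a s \<equiv> frac_rel R M `` {(a, s)}"

sublocale Loc: cring Loc
  by (rule cring_localization[OF prime_M])

lemma M_subset: "M \<subseteq> carrier R"
  using prime_M by (simp add: additive_subgroup.a_subset primeideal_def ideal_def)

lemma zero_in_M: "\<zero> \<in> M"
  using prime_M by (simp add: additive_subgroup.zero_closed primeideal_def ideal_def)

lemma one_notin_M: "\<one> \<in> carrier R - M"
  by (rule prime_complement(1)[OF prime_M])

text \<open>The multiplier \<open>w\<close> of \<open>frac_rel\<close> lies outside
  \<open>M\<close>, so it is nonzero and cancels in a domain.\<close>

lemma frac_eq_iff:
  assumes "a \<in> carrier R" "b \<in> carrier R" "s \<in> carrier R - M" "t \<in> carrier R - M"
  shows "frac a s = frac b t \<longleftrightarrow> a \<otimes> t = b \<otimes> s"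
proof
  assume "frac a s = frac b t"
  then have "((a, s), (b, t)) \<in> frac_rel R M"
    using assms by (subst (asm) eq_equiv_class_iff[OF equiv_frac_rel[OF prime_M]]) auto
  then obtain w where w: "w \<in> carrier R - M" "w \<otimes> (a \<otimes> t) = w \<otimes> (b \<otimes> s)"
    unfolding frac_rel_iff by blast
  moreover have "w \<noteq> \<zero>"
    using w(1) zero_in_M by blast
  ultimately show "a \<otimes> t = b \<otimes> s"
    using assms m_lcancel[of w "a \<otimes> t" "b \<otimes> s"] by auto
qed (rule frac_eqI[OF prime_M assms])

section \<open>Primes of the localization and a lower bound for its dimension\<close>

definition extension :: "'a set \<Rightarrow> ('a \<times> 'a) set set" where
  "extension P = {frac a s | a s. a \<in> P \<and> s \<in> carrier R - M}"

text \<open>Denominators lie outside \<open>M\<close>, hence outside \<open>P\<close>. From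
  \<open>a t = b s\<close> in \<open>P\<close> primality therefore yields \<open>a\<close> in
  \<open>P\<close>, so membership can be read off any representative.\<close>

lemma frac_in_extension_iff:
  assumes "primeideal P R" "P \<subseteq> M" "a \<in> carrier R" "s \<in> carrier R - M"
  shows "frac a s \<in> extension P \<longleftrightarrow> a \<in> P"
proof
  interpret P: primeideal P R by fact
  assume "frac a s \<in> extension P"
  then obtain b t where bt: "b \<in> P" "t \<in> carrier R - M" "frac a s = frac b t"
    unfolding extension_def by blast
  then have "a \<otimes> t = b \<otimes> s"
    using assms frac_eq_iff[of a b s t] P.Icarr by blast
  moreover have "b \<otimes> s \<in> P"
    using bt assms P.I_r_closed by blast
  ultimately show "a \<in> P"
    using P.I_prime[of a t] bt assms by auto
qed (use assms in \<open>auto simp: extension_def\<close>)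

text \<open>By \<open>frac_in_extension_iff\<close> every condition becomes one on numerators;
  properness comes from \<open>P\<close> being contained in \<open>M\<close>.\<close>

lemma primeideal_extension:
  assumes "primeideal P R" "P \<subseteq> M"
  shows "primeideal (extension P) Loc"
proof (rule primeidealI2)
  interpret P: primeideal P R by fact
  note S = prime_complement[OF prime_M]
  note [simp] = localization_simps[OF prime_M]
  note mem = frac_in_extension_iff[OF assms]
  have extE: "\<exists>a s. a \<in> P \<and> a \<in> carrier R \<and> s \<in> carrier R - M \<and> X = frac a s"
    if "X \<in> extension P" for X
    using that P.Icarr by (auto simp: extension_def)
  have neg: "\<ominus>\<^bsub>Loc\<^esub> frac a s = frac (\<ominus> a) s" if "a \<in> carrier R" "s \<in> carrier R - M" for a s
  proof (rule Loc.minus_equality)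
    show "frac (\<ominus> a) s \<oplus>\<^bsub>Loc\<^esub> frac a s = \<zero>\<^bsub>Loc\<^esub>"
      unfolding localization_consts using that S
      by (simp del: Diff_iff, subst frac_eq_iff) (auto simp: l_minus l_neg)
  qed (use that in \<open>auto intro!: localization_carrierI\<close>)
  show "additive_subgroup (extension P) Loc"
  proof (rule additive_subgroup.intro, rule Loc.add.subgroupI)
    show "extension P \<subseteq> carrier Loc"
      using P.Icarr by (auto simp: extension_def intro!: localization_carrierI)
    show "extension P \<noteq> {}"
      using frac_in_extension_iff[OF assms, of \<zero> \<one>] P.zero_closed one_notin_M by blast
  next
    fix X assume "X \<in> extension P"
    then obtain a s where X: "a \<in> P" "a \<in> carrier R" "s \<in> carrier R - M" "X = frac a s"
      using extE by blast
    show "\<ominus>\<^bsub>Loc\<^esub> X \<in> extension P"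
      unfolding X(4) neg[OF X(2,3)] using X mem[of "\<ominus> a" s] P.a_inv_closed by auto
  next
    fix X Y assume "X \<in> extension P" "Y \<in> extension P"
    then obtain a s b t where X: "a \<in> P" "a \<in> carrier R" "s \<in> carrier R - M" "X = frac a s"
      and Y: "b \<in> P" "b \<in> carrier R" "t \<in> carrier R - M" "Y = frac b t"
      using extE by meson
    have "a \<otimes> t \<oplus> b \<otimes> s \<in> P"
      using X Y P.I_r_closed P.a_closed by blast
    then show "X \<oplus>\<^bsub>Loc\<^esub> Y \<in> extension P"
      using X Y S(2)[OF X(3) Y(3)] mem[of "a \<otimes> t \<oplus> b \<otimes> s" "s \<otimes> t"] P.Icarr
      by (simp del: Diff_iff)
  qed
  show "cring Loc"
    by (rule Loc.is_cring)
  show l: "X \<otimes>\<^bsub>Loc\<^esub> Y \<in> extension P" if YX: "Y \<in> extension P" "X \<in> carrier Loc" for X Y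
  proof -
    obtain a s b t where X: "a \<in> carrier R" "s \<in> carrier R - M" "X = frac a s"
      and Y: "b \<in> P" "b \<in> carrier R" "t \<in> carrier R - M" "Y = frac b t"
      using extE[OF YX(1)] localization_carrier_cases[OF YX(2)] by metis
    have "a \<otimes> b \<in> P"
      using X Y P.I_l_closed by blast
    then show ?thesis
      using X Y S(2)[OF X(2) Y(3)] mem[of "a \<otimes> b" "s \<otimes> t"] P.Icarr by (simp del: Diff_iff)
  qed
  show "X \<otimes>\<^bsub>Loc\<^esub> Y \<in> extension P" if XY: "X \<in> extension P" "Y \<in> carrier Loc" for X Y
  proof -
    have "X \<in> carrier Loc"
      using XY(1) P.Icarr by (auto simp: extension_def intro!: localization_carrierI)
    then show ?thesis
      using l[OF XY] XY Loc.m_comm by simp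
  qed
  have "\<one>\<^bsub>Loc\<^esub> \<notin> extension P"
    unfolding localization_consts using mem[of \<one> \<one>] one_notin_M assms(2) by auto
  then show "carrier Loc \<noteq> extension P"
    by auto
  show "X \<in> extension P \<or> Y \<in> extension P"
    if XY: "X \<in> carrier Loc" "Y \<in> carrier Loc" "X \<otimes>\<^bsub>Loc\<^esub> Y \<in> extension P" for X Y
  proof -
    obtain a s b t where X: "a \<in> carrier R" "s \<in> carrier R - M" "X = frac a s"
      and Y: "b \<in> carrier R" "t \<in> carrier R - M" "Y = frac b t"
      using localization_carrier_cases[OF XY(1)] localization_carrier_cases[OF XY(2)] by metis
    have "a \<otimes> b \<in> P"
      using XY(3) X Y S(2)[OF X(2) Y(2)] mem[of "a \<otimes> b" "s \<otimes> t"] by (simp del: Diff_iff)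
    then show ?thesis
      using X Y mem P.I_prime by (metis (no_types))
  qed
qed

lemma extension_strict_mono:
  assumes "primeideal P R" "primeideal Q R" "P \<subset> Q" "Q \<subseteq> M"
  shows "extension P \<subset> extension Q"
proof -
  obtain a where a: "a \<in> Q" "a \<notin> P" "a \<in> carrier R"
    using assms M_subset by blast
  have "frac a \<one> \<in> extension Q" "frac a \<one> \<notin> extension P"
    using a one_notin_M assms frac_in_extension_iff by auto
  then show ?thesis
    using assms(3) unfolding extension_def by blast
qed

text \<open>Extension keeps the inclusions of a chain strict, so chains of primes inside
  \<open>M\<close> bound the dimension from below.\<close>

lemma krull_dim_Loc_ge:
  assumes "\<forall>Q \<in> set Qs. primeideal Q R \<and> Q \<subseteq> M" "sorted_wrt (\<subset>) Qs" "length Qs = Suc k"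
  shows "enat k \<le> krull_dim Loc"
proof -
  have "sorted_wrt (\<subset>) (map extension Qs)"
    unfolding sorted_wrt_map
    by (rule sorted_wrt_mono_rel[OF _ assms(2)], rule extension_strict_mono) (use assms(1) in auto)
  moreover have "\<forall>Q \<in> set (map extension Qs). primeideal Q Loc"
    using assms(1) primeideal_extension by auto
  ultimately show ?thesis
    unfolding krull_dim_def using assms(3)
    by (intro Sup_upper CollectI exI[of _ k] exI[of _ "map extension Qs"]) simp
qed

lemma ideal_Loc_numerator:
  assumes "ideal J Loc" "J \<noteq> carrier Loc" "X \<in> J"
  obtains a s where "a \<in> M" "a \<in> carrier R" "s \<in> carrier R - M" "X = frac a s"
proof -
  interpret J: ideal J Loc by fact
  obtain a s where X: "a \<in> carrier R" "s \<in> carrier R - M" "X = frac a s"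
    using J.Icarr[OF assms(3)] localization_carrier_cases by metis
  have "a \<in> M"
  proof (rule ccontr)
    assume "a \<notin> M"
    then have a: "a \<in> carrier R - M" using X by blast
    \<comment> \<open>A numerator outside \<open>M\<close> would make \<open>X = a / s\<close> a
      unit with inverse \<open>s / a\<close>.\<close>
    have "frac s a \<otimes>\<^bsub>Loc\<^esub> X = \<one>\<^bsub>Loc\<^esub>"
      using X a prime_complement(2)[OF prime_M a X(2)] one_notin_M
      unfolding localization_consts X(3) localization_simps(1)[OF prime_M _ X(1) a X(2), of s, simplified X(2)]
      by (subst localization_simps(1)[OF prime_M]; (subst frac_eq_iff)?) (auto simp: m_comm)
    moreover have "frac s a \<in> carrier Loc"
      using X a by (auto intro: localization_carrierI)
    ultimately have "\<one>\<^bsub>Loc\<^esub> \<in> J"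
      using J.I_l_closed[OF assms(3)] by metis
    then show False
      using J.one_imp_carrier assms(2) by blast
  qed
  with X that show thesis by blast
qed

text \<open>\<open>M\<close> is an associated prime of \<open>R / (f)\<close>, witnessed by \<open>b\<close>. The class of \<open>b / f\<close> then
  turns every first member of a regular sequence into an obstruction for the second.\<close>

lemma local_depth_Loc_le_1:
  assumes f: "f \<in> carrier R" "f \<noteq> \<zero>" and b: "b \<in> carrier R"
    and M_eq: "M = {r \<in> carrier R. \<exists>r' \<in> carrier R. r \<otimes> b = f \<otimes> r'}"
  shows "local_depth Loc \<le> 1"
  unfolding local_depth_def
proof (rule Sup_least, clarify)
  fix xs J
  assume J: "maximalideal J Loc" and xs: "set xs \<subseteq> J" "regular_sequence Loc xs"
  interpret J: maximalideal J Loc by fact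
  note S = prime_complement[OF prime_M]
  note [simp] = localization_simps[OF prime_M]
  have nontriv: "\<one>\<^bsub>Loc\<^esub> \<noteq> \<zero>\<^bsub>Loc\<^esub>"
    using J.I_notcarr J.one_imp_carrier J.zero_closed by auto
  show "enat (length xs) \<le> 1"
  proof (rule ccontr)
    assume "\<not> enat (length xs) \<le> 1"
    then have len: "length xs > 1"
      by (simp add: one_enat_def)
    define X Y where "X = xs ! 0" and "Y = xs ! 1"
    have "X \<in> J" "Y \<in> J"
      unfolding X_def Y_def using len by (auto intro!: subsetD[OF xs(1)] nth_mem)
    then obtain a s c w where
      X: "a \<in> M" "a \<in> carrier R" "s \<in> carrier R - M" "X = frac a s" and
      Y: "c \<in> M" "c \<in> carrier R" "w \<in> carrier R - M" "Y = frac c w"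
      using ideal_Loc_numerator[OF J.ideal_axioms] J.I_notcarr by metis
    have Xc: "X \<in> carrier Loc" and Yc: "Y \<in> carrier Loc"
      using \<open>X \<in> J\<close> \<open>Y \<in> J\<close> J.Icarr by auto
    \<comment> \<open>Multiplication by the fraction \<open>b / f\<close> sends \<open>M\<close>
      into \<open>R\<close>: \<open>a' = a b / f\<close> and \<open>c' = c b / f\<close>.\<close>
    obtain a' c' where a': "a' \<in> carrier R" "a \<otimes> b = f \<otimes> a'" and c': "c' \<in> carrier R" "c \<otimes> b = f \<otimes> c'"
      using X(1) Y(1) M_eq by blast
    have take1: "set (take 1 xs) = {X}"
      using len by (cases xs) (auto simp: X_def)
    have reg0: "Z \<in> Idl\<^bsub>Loc\<^esub> {}" if "Z \<in> carrier Loc" "X \<otimes>\<^bsub>Loc\<^esub> Z \<in> Idl\<^bsub>Loc\<^esub> {}" for Z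
      using xs(2) len that unfolding regular_sequence_def X_def by (force dest: spec[of _ 0])
    have reg1: "Z \<in> PIdl\<^bsub>Loc\<^esub> X" if "Z \<in> carrier Loc" "Y \<otimes>\<^bsub>Loc\<^esub> Z \<in> PIdl\<^bsub>Loc\<^esub> X" for Z
      using xs(2) len that take1 Loc.cgenideal_eq_genideal[OF Xc]
      unfolding regular_sequence_def Y_def by (metis)
    \<comment> \<open>Were \<open>X\<close> zero, it would annihilate one, and regularity over the
      empty set of generators would put one into the zero ideal.\<close>
    have "a \<noteq> \<zero>"
    proof
      assume "a = \<zero>"
      then have "X = \<zero>\<^bsub>Loc\<^esub>"
        unfolding X(4) localization_consts using X one_notin_M by (subst frac_eq_iff) auto
      moreover have "\<zero>\<^bsub>Loc\<^esub> \<in> Idl\<^bsub>Loc\<^esub> {}"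
        by (meson Loc.genideal_ideal additive_subgroup.zero_closed empty_subsetI ideal_def)
      ultimately have "\<one>\<^bsub>Loc\<^esub> \<in> Idl\<^bsub>Loc\<^esub> {}"
        using reg0[of "\<one>\<^bsub>Loc\<^esub>"] by simp
      moreover have "Idl\<^bsub>Loc\<^esub> {} \<subseteq> {\<zero>\<^bsub>Loc\<^esub>}"
        by (rule Loc.genideal_minimal) (auto simp: Loc.zeroideal)
      ultimately show False
        using nontriv by blast
    qed
    \<comment> \<open>Both \<open>c a'\<close> and \<open>c' a\<close> equal
      \<open>a c b / f\<close>; this is checked after multiplying by \<open>f\<close>.\<close>
    have "f \<otimes> (c \<otimes> a') = c \<otimes> (a \<otimes> b)"
      unfolding a'(2) using f Y a' by (simp add: m_ac)
    also have "\<dots> = a \<otimes> (c \<otimes> b)"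
      using X Y b by (simp add: m_ac)
    also have "\<dots> = f \<otimes> (c' \<otimes> a)"
      unfolding c'(2) using f X c' by (simp add: m_ac)
    finally have swap: "c \<otimes> a' = c' \<otimes> a"
      using f X Y a' c' m_lcancel[of f "c \<otimes> a'" "c' \<otimes> a"] by auto
    \<comment> \<open>Hence \<open>Y\<close> sends the class of \<open>a'\<close> modulo
      \<open>X\<close> to zero, and regularity of \<open>Y\<close> will force \<open>a'\<close> into
      the ideal of \<open>X\<close>.\<close>
    have "Y \<otimes>\<^bsub>Loc\<^esub> frac a' \<one> = frac (s \<otimes> c') w \<otimes>\<^bsub>Loc\<^esub> X"
    proof -
      have mem: "a' \<in> carrier R" "s \<otimes> c' \<in> carrier R" "w \<otimes> \<one> \<in> carrier R - M" "w \<otimes> s \<in> carrier R - M"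
        using X Y a' c' one_notin_M S(2) by auto
      have "(c \<otimes> a') \<otimes> (w \<otimes> s) = (c' \<otimes> a) \<otimes> (w \<otimes> s)"
        by (simp only: swap)
      also have "\<dots> = ((s \<otimes> c') \<otimes> a) \<otimes> (w \<otimes> \<one>)"
        using X Y a' c' by (simp add: m_ac)
      finally have "frac (c \<otimes> a') (w \<otimes> \<one>) = frac ((s \<otimes> c') \<otimes> a) (w \<otimes> s)"
        using mem X Y by (intro frac_eqI[OF prime_M]) auto
      then show ?thesis
        unfolding X(4) Y(4) using X Y mem one_notin_M by simp
    qed
    moreover have "frac (s \<otimes> c') w \<in> carrier Loc"
      using X Y c' by (intro localization_carrierI) auto
    ultimately have "Y \<otimes>\<^bsub>Loc\<^esub> frac a' \<one> \<in> PIdl\<^bsub>Loc\<^esub> X"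
      unfolding cgenideal_def by blast
    then have "frac a' \<one> \<in> PIdl\<^bsub>Loc\<^esub> X"
      by (rule reg1[OF localization_carrierI[OF a'(1) one_notin_M]])
    then obtain Z where "Z \<in> carrier Loc" "frac a' \<one> = Z \<otimes>\<^bsub>Loc\<^esub> X"
      unfolding cgenideal_def by blast
    then obtain y z where yz: "y \<in> carrier R" "z \<in> carrier R - M" "frac a' \<one> = frac y z \<otimes>\<^bsub>Loc\<^esub> X"
      by (blast elim: localization_carrier_cases)
    then have "frac a' \<one> = frac (y \<otimes> a) (z \<otimes> s)"
      using X by simp
    then have "a' \<otimes> (z \<otimes> s) = y \<otimes> a \<otimes> \<one>"
      using frac_eq_iff[of a' "y \<otimes> a" \<one> "z \<otimes> s"] a' yz X one_notin_M S(2) by auto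
    then have eq: "a' \<otimes> (z \<otimes> s) = y \<otimes> a"
      using yz X by simp
    \<comment> \<open>Multiplying \<open>a' z s = y a\<close> by \<open>b / f\<close> in effect
      undoes the passage from \<open>a\<close> to \<open>a'\<close>: cancelling \<open>a\<close>
      shows that \<open>z s\<close> carries \<open>b\<close> into \<open>(f)\<close>, so
      \<open>z s\<close> lies in \<open>M\<close>, against the choice of denominators.\<close>
    have "a \<otimes> (z \<otimes> s \<otimes> b) = (a \<otimes> b) \<otimes> (z \<otimes> s)"
      using X yz b by (simp add: m_ac)
    also have "\<dots> = f \<otimes> (a' \<otimes> (z \<otimes> s))"
      unfolding a'(2) using X yz f a' by (simp add: m_ac)
    also have "\<dots> = a \<otimes> (f \<otimes> y)"
      unfolding eq using X yz f by (simp add: m_ac)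
    finally have "z \<otimes> s \<otimes> b = f \<otimes> y"
      using \<open>a \<noteq> \<zero>\<close> X yz b f m_lcancel[of a "z \<otimes> s \<otimes> b" "f \<otimes> y"] by auto
    moreover have "z \<otimes> s \<in> carrier R - M"
      by (rule S(2)[OF yz(2) X(3)])
    ultimately show False
      using M_eq yz(1) by blast
  qed
qed

end

section \<open>Semigroups of projective monomial curves\<close>

text \<open>The elements of \<open>G\<close> are treated one after another: \<open>t\<close> is
  moved by the last multiple of \<open>a\<close> that stays outside \<open>S\<close>. Elements
  treated before remain absorbed because \<open>S\<close> is closed under adding \<open>a\<close>.
  The set \<open>T\<close> is an invariant that keeps absorption available after each move.\<close>

lemma obtain_maximal_gap:
  fixes S :: "'a::comm_monoid_add set"
  assumes "finite G" "s \<in> T" "s \<notin> S"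
    and S_closed: "\<And>x a. x \<in> S \<Longrightarrow> a \<in> G \<Longrightarrow> x + a \<in> S"
    and T_closed: "\<And>x a. x \<in> T \<Longrightarrow> a \<in> G \<Longrightarrow> x + a \<in> T"
    and absorb: "\<And>x a. x \<in> T \<Longrightarrow> a \<in> G \<Longrightarrow> \<exists>N::nat. x + (\<Sum>j<N. a) \<in> S"
  obtains t where "t \<notin> S" "\<And>a. a \<in> G \<Longrightarrow> t + a \<in> S"
proof -
  have "\<exists>t\<in>T. t \<notin> S \<and> (\<forall>a\<in>F. t + a \<in> S)" if "F \<subseteq> G" for F
    using finite_subset[OF that assms(1)] that
  proof (induction F rule: finite_induct)
    case empty
    show ?case using assms(2,3) by blast
  next
    case (insert a F)
    then obtain t where t: "t \<in> T" "t \<notin> S" "\<forall>b\<in>F. t + b \<in> S" and a: "a \<in> G"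
      by blast
    \<comment> \<open>\<open>N\<close> is the first multiple that enters \<open>S\<close>. It is
      positive since \<open>t\<close> is outside \<open>S\<close>, so its predecessor
      \<open>k\<close> is the last one outside.\<close>
    define N where "N = (LEAST N::nat. t + (\<Sum>j<N. a) \<in> S)"
    have N: "t + (\<Sum>j<N. a) \<in> S"
      unfolding N_def using absorb[OF t(1) a] by (rule LeastI_ex)
    have "N \<noteq> 0"
      using N t(2) by (cases N) auto
    then obtain k where k: "N = Suc k"
      by (cases N) auto
    have mult: "x + (\<Sum>j<i. a) \<in> X" if "x \<in> X" "\<And>y. y \<in> X \<Longrightarrow> y + a \<in> X" for x X and i :: nat
      using that by (induction i) (auto simp: add.assoc[symmetric])
    let ?t = "t + (\<Sum>j<k. a)"
    have "?t \<in> T"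
      using mult[OF t(1)] T_closed a by blast
    moreover have "?t \<notin> S"
      using not_less_Least[of k "\<lambda>N::nat. t + (\<Sum>j<N. a) \<in> S"] k unfolding N_def by simp
    moreover have "?t + a \<in> S"
      using N k by (simp add: add.assoc)
    moreover have "?t + b \<in> S" if "b \<in> F" for b
      using mult[of "t + b" S] t(3) that S_closed a by (simp add: add_ac)
    ultimately show ?case
      by blast
  qed
  then show thesis
    using that by blast
qed

section \<open>Exponents, the semigroup and its grading\<close>

definition curve_exponent :: "nat \<Rightarrow> (nat \<Rightarrow> nat) \<Rightarrow> nat \<Rightarrow> param \<Rightarrow>\<^sub>0 nat" where
  "curve_exponent n m i = (if i = n + 1 then Poly_Mapping.single Param_v (m n)
     else Poly_Mapping.single Param_u (m i) + Poly_Mapping.single Param_v (m n - m i))"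

text \<open>Adding one generator at a time lets case analysis split a generator off any nonzero
  element.\<close>

inductive_set curve_semigroup :: "nat \<Rightarrow> (nat \<Rightarrow> nat) \<Rightarrow> (param \<Rightarrow>\<^sub>0 nat) set" for n m where
  zero: "0 \<in> curve_semigroup n m"
| add_generator: "s \<in> curve_semigroup n m \<Longrightarrow> i \<in> {1..n + 1} \<Longrightarrow>
    s + curve_exponent n m i \<in> curve_semigroup n m"

lemma curve_semigroup_add:
  assumes "s \<in> curve_semigroup n m" "t \<in> curve_semigroup n m"
  shows "s + t \<in> curve_semigroup n m"
  using assms(2,1)
  by induction (auto simp: add.assoc[symmetric] intro: curve_semigroup.intros)

lemma curve_semigroup_generator: "i \<in> {1..n + 1} \<Longrightarrow> curve_exponent n m i \<in> curve_semigroup n m"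
  using curve_semigroup.add_generator[OF curve_semigroup.zero] by fastforce

lemma curve_semigroup_sum:
  "(\<And>x. x \<in> A \<Longrightarrow> f x \<in> curve_semigroup n m) \<Longrightarrow> sum f A \<in> curve_semigroup n m"
  by (induction A rule: infinite_finite_induct) (auto intro: curve_semigroup.zero curve_semigroup_add)

lemma param_exponent_eqI:
  fixes s t :: "param \<Rightarrow>\<^sub>0 nat"
  assumes "Poly_Mapping.lookup s Param_u = Poly_Mapping.lookup t Param_u"
    and "Poly_Mapping.lookup s Param_v = Poly_Mapping.lookup t Param_v"
  shows "s = t"
  by (rule poly_mapping_eqI) (metis (full_types) assms param.exhaust)

lemma lookup_curve_exponent:
  "Poly_Mapping.lookup (curve_exponent n m i) Param_u = (if i = n + 1 then 0 else m i)"
  "Poly_Mapping.lookup (curve_exponent n m i) Param_v = (if i = n + 1 then m n else m n - m i)"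
  by (simp_all add: curve_exponent_def lookup_add lookup_single)

text \<open>Every generator has total degree \<open>m n\<close>, so \<open>k\<close> counts the
  summands, and an element with one summand is a generator.\<close>

lemma curve_semigroup_degree:
  assumes "s \<in> curve_semigroup n m" "\<And>i. i \<in> {1..n} \<Longrightarrow> m i \<le> m n"
  obtains k where "Poly_Mapping.lookup s Param_u + Poly_Mapping.lookup s Param_v = k * m n"
    "k = 1 \<Longrightarrow> m n > 0 \<Longrightarrow> \<exists>i \<in> {1..n + 1}. s = curve_exponent n m i"
proof -
  have deg: "Poly_Mapping.lookup (curve_exponent n m i) Param_u +
      Poly_Mapping.lookup (curve_exponent n m i) Param_v = m n" if "i \<in> {1..n + 1}" for i
    using that assms(2)[of i] by (auto simp: lookup_curve_exponent)
  \<comment> \<open>The clause for \<open>k = 0\<close> strengthens the induction: it identifies the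
    single generator when \<open>k\<close> reaches 1.\<close>
  have "\<exists>k. Poly_Mapping.lookup s Param_u + Poly_Mapping.lookup s Param_v = k * m n \<and>
      (k = 0 \<longrightarrow> s = 0) \<and> (k = 1 \<longrightarrow> (\<exists>i \<in> {1..n + 1}. s = curve_exponent n m i))"
    using assms(1)
  proof induction
    case zero
    show ?case by (intro exI[of _ 0]) auto
  next
    case (add_generator s i)
    then obtain k where k: "Poly_Mapping.lookup s Param_u + Poly_Mapping.lookup s Param_v = k * m n"
      "k = 0 \<longrightarrow> s = 0" by blast
    show ?case
      by (rule exI[of _ "Suc k"])
         (use k deg[OF add_generator(2)] add_generator(2) in \<open>auto simp: lookup_add\<close>)
  qed
  with that show thesis by blast
qed

section \<open>The gap left by a generalized arithmetic sequence\<close>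

locale arithmetic_gap =
  fixes n l h d :: nat and m i :: "nat \<Rightarrow> nat"
  assumes pos: "\<And>j. j \<in> {1..n} \<Longrightarrow> m j > 0"
    and mono: "strict_mono_on {1..n} m"
    and l: "l \<ge> 3"
    and i_mono: "strict_mono_on {1..l} i"
    and i_1: "i 1 \<ge> 1"
    and i_l: "i l = n"
    and d: "d > 0"
    and seq: "\<And>j. j \<in> {2..l} \<Longrightarrow> m (i j) = h * m (i 1) + (j - 1) * d"
    and h: "h > 1"
    and gap: "h * m (i 1) \<notin> m ` {1..n}"
begin

abbreviation "S \<equiv> curve_semigroup n m"
abbreviation "a \<equiv> curve_exponent n m"
abbreviation "deg_u s \<equiv> Poly_Mapping.lookup s Param_u"
abbreviation "deg_v s \<equiv> Poly_Mapping.lookup s Param_v"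

lemma i_in: "j \<in> {1..l} \<Longrightarrow> i j \<in> {1..n}"
  using strict_mono_on_leD[OF i_mono, of 1 j] strict_mono_on_leD[OF i_mono, of j l] i_1 i_l l by auto

lemma n_pos: "n \<in> {1..n}"
  using i_in[of l] i_l l by auto

lemma m_le: "j \<in> {1..n} \<Longrightarrow> m j \<le> m n"
  using strict_mono_on_leD[OF mono, of j n] n_pos by auto

lemma a_n: "a n = Poly_Mapping.single Param_u (m n)"
  and a_Suc_n: "a (n + 1) = Poly_Mapping.single Param_v (m n)"
  by (simp_all add: curve_exponent_def)

lemma m_n: "m n = h * m (i 1) + (l - 1) * d"
  using seq[of l] i_l l by simp

text \<open>The subtraction does not truncate, by \<open>m_n\<close>, so the total degree is
  \<open>m n\<close>, as for the generators.\<close>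

definition gap_exponent :: "param \<Rightarrow>\<^sub>0 nat" where
  "gap_exponent = Poly_Mapping.single Param_u (h * m (i 1)) + Poly_Mapping.single Param_v (m n - h * m (i 1))"

lemma lookup_gap_exponent: "deg_u gap_exponent = h * m (i 1)" "deg_v gap_exponent = m n - h * m (i 1)"
  by (simp_all add: gap_exponent_def lookup_add lookup_single)

text \<open>Having degree one, it could only be a generator. Its u-part is no \<open>m j\<close> by
  \<open>gap\<close>, and it is positive, which excludes the generator with index
  \<open>n + 1\<close>.\<close>

lemma gap_exponent_notin: "gap_exponent \<notin> S"
proof
  assume "gap_exponent \<in> S"
  then obtain k where k: "deg_u gap_exponent + deg_v gap_exponent = k * m n"
    "k = 1 \<Longrightarrow> m n > 0 \<Longrightarrow> \<exists>j \<in> {1..n + 1}. gap_exponent = a j"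
    using curve_semigroup_degree m_le by metis
  have "m n > 0"
    using pos n_pos by blast
  moreover have "k * m n = m n"
    using k(1) m_n unfolding lookup_gap_exponent by linarith
  ultimately obtain j where j: "j \<in> {1..n + 1}" "gap_exponent = a j"
    using k(2) by auto
  then have "h * m (i 1) = (if j = n + 1 then 0 else m j)"
    using lookup_gap_exponent(1) lookup_curve_exponent(1) by metis
  moreover have "h * m (i 1) > 0"
    using h pos i_in[of 1] l by simp
  ultimately show False
    using gap j(1) by (auto split: if_splits)
qed

text \<open>In the progression starting at \<open>h * m (i 1)\<close>, first plus last term equals
  second plus next to last. As \<open>l\<close> is at least 3, the latter two occur among the
  \<open>m j\<close>; for \<open>l = 3\<close> they coincide.\<close>

lemma gap_exponent_add_u: "gap_exponent + a n = a (i 2) + a (i (l - 1))"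
proof (rule param_exponent_eqI)
  have "i 2 \<in> {1..n}" "i (l - 1) \<in> {1..n}"
    using i_in l by auto
  then have ne: "i 2 \<noteq> n + 1" "i (l - 1) \<noteq> n + 1"
    by auto
  obtain k where k: "l = k + 3"
    using l by (metis add.commute le_Suc_ex)
  have m2: "m (i 2) = h * m (i 1) + d" and ml: "m (i (l - 1)) = h * m (i 1) + (k + 1) * d"
    using seq[of 2] seq[of "l - 1"] k by auto
  have mn: "m n = h * m (i 1) + (k + 2) * d"
    using m_n k by simp
  show "deg_u (gap_exponent + a n) = deg_u (a (i 2) + a (i (l - 1)))"
    using ne unfolding lookup_add lookup_gap_exponent lookup_curve_exponent m2 ml mn
    by (simp add: algebra_simps mn)
  show "deg_v (gap_exponent + a n) = deg_v (a (i 2) + a (i (l - 1)))"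
    using ne unfolding lookup_add lookup_gap_exponent lookup_curve_exponent m2 ml
    by (simp add: mn algebra_simps)
qed

text \<open>The sum of \<open>h\<close> copies of \<open>a (i 1)\<close> has the same u-part as the
  gap and total degree \<open>h * m n\<close>; copies of the pure v-generator fill the
  difference.\<close>

lemma gap_exponent_add_v: "gap_exponent + (\<Sum>j<h - 1. a (n + 1)) = (\<Sum>j<h. a (i 1))"
proof (rule param_exponent_eqI)
  have "i 1 \<in> {1..n}"
    using i_in l by auto
  then have ne: "i 1 \<noteq> n + 1"
    by auto
  have le: "h * m (i 1) \<le> m n"
    using m_n by simp
  show "deg_u (gap_exponent + (\<Sum>j<h - 1. a (n + 1))) = deg_u (\<Sum>j<h. a (i 1))"
    using ne by (simp add: lookup_add lookup_sum lookup_gap_exponent lookup_curve_exponent)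
  have "(h - 1) * m n = h * m n - m n"
    by (simp add: diff_mult_distrib)
  moreover have "m n \<le> h * m n"
    using h by simp
  ultimately show "deg_v (gap_exponent + (\<Sum>j<h - 1. a (n + 1))) = deg_v (\<Sum>j<h. a (i 1))"
    using ne le
    by (simp add: lookup_add lookup_sum lookup_gap_exponent lookup_curve_exponent diff_mult_distrib2)
qed

text \<open>Reduces absorption by an arbitrary generator to the two pure powers of u and v.\<close>

lemma multiple_generator:
  assumes "j \<in> {1..n}"
  shows "(\<Sum>k<m n. a j) = (\<Sum>k<m j. a n) + (\<Sum>k<m n - m j. a (n + 1))"
  using assms
  by (intro param_exponent_eqI) (auto simp: lookup_add lookup_sum lookup_curve_exponent)

lemma ex_socle_exponent:
  obtains s where "s \<notin> S" "\<And>j. j \<in> {1..n + 1} \<Longrightarrow> s + a j \<in> S"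
proof -
  \<comment> \<open>Absorption is required for the two pure generators only. Both conditions survive
    adding elements of \<open>S\<close>, and the gap satisfies them.\<close>
  define T where "T = {s. s + a n \<in> S \<and> (\<exists>N::nat. s + (\<Sum>k<N. a (n + 1)) \<in> S)}"
  have gens: "a j \<in> S" if "j \<in> {1..n + 1}" for j
    using curve_semigroup_generator that by blast
  have gap_T: "gap_exponent \<in> T"
  proof -
    have "i 2 \<in> {1..n}" "i (l - 1) \<in> {1..n}" "i 1 \<in> {1..n}"
      using i_in l by auto
    then have "gap_exponent + a n \<in> S" "gap_exponent + (\<Sum>k<h - 1. a (n + 1)) \<in> S"
      unfolding gap_exponent_add_u gap_exponent_add_v
      by (auto intro!: curve_semigroup_add curve_semigroup_sum gens)
    then show ?thesis
      unfolding T_def by (intro CollectI conjI exI[of _ "h - 1"])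
  qed
  have S_closed: "x + b \<in> S" if "x \<in> S" "b \<in> a ` {1..n + 1}" for x b
    using that curve_semigroup_add gens by blast
  have T_closed: "x + b \<in> T" if x: "x \<in> T" "b \<in> a ` {1..n + 1}" for x b
  proof -
    obtain N :: nat where "x + a n \<in> S" "x + (\<Sum>k<N. a (n + 1)) \<in> S" and b: "b \<in> S"
      using x gens unfolding T_def by blast
    then have "(x + a n) + b \<in> S" "(x + (\<Sum>k<N. a (n + 1))) + b \<in> S"
      using curve_semigroup_add by blast+
    then have "x + b + a n \<in> S" "x + b + (\<Sum>k<N. a (n + 1)) \<in> S"
      by (simp_all add: add_ac)
    then show ?thesis
      unfolding T_def by blast
  qed
  have absorb: "\<exists>N::nat. x + (\<Sum>k<N. b) \<in> S" if x: "x \<in> T" "b \<in> a ` {1..n + 1}" for x b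
  proof -
    obtain j where j: "j \<in> {1..n + 1}" "b = a j"
      using x by blast
    show ?thesis
    proof (cases "j = n + 1")
      case True
      then show ?thesis using x j unfolding T_def by blast
    next
      case False
      then have j': "j \<in> {1..n}"
        using j by auto
      \<comment> \<open>As \<open>m j > 0\<close>, the multiple of \<open>b\<close> contains a copy
        of \<open>a n\<close>; attached to \<open>x\<close> it lands in \<open>S\<close> because
        \<open>x\<close> is in \<open>T\<close>.\<close>
      then obtain k where k: "m j = Suc k"
        using pos gr0_conv_Suc by blast
      have "(x + a n) + ((\<Sum>k<k. a n) + (\<Sum>k<m n - m j. a (n + 1))) \<in> S"
      proof (rule curve_semigroup_add)
        show "x + a n \<in> S"
          using x unfolding T_def by blast
      qed (use n_pos in \<open>auto intro!: curve_semigroup_add curve_semigroup_sum gens\<close>)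
      then have "x + (\<Sum>k<m n. b) \<in> S"
        unfolding j(2) multiple_generator[OF j'] k by (simp add: add_ac)
      then show ?thesis ..
    qed
  qed
  obtain s where "s \<notin> S" "\<And>b. b \<in> a ` {1..n + 1} \<Longrightarrow> s + b \<in> S"
    by (rule obtain_maximal_gap[OF _ gap_T gap_exponent_notin S_closed T_closed absorb]) auto
  then show thesis
    using that by blast
qed

end

section \<open>The coordinate ring as a semigroup ring\<close>

text \<open>An order on the variables yields a linear order on exponents, through which the
  polynomial type has no zero divisors.\<close>

instantiation param :: linorder
begin

definition less_eq_param :: "param \<Rightarrow> param \<Rightarrow> bool" where
  "less_eq_param x y \<longleftrightarrow> x = Param_u \<or> y = Param_v"

definition less_param :: "param \<Rightarrow> param \<Rightarrow> bool" where
  "less_param x y \<longleftrightarrow> x = Param_u \<and> y = Param_v"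

instance
  by standard (auto simp: less_eq_param_def less_param_def intro: param.exhaust)

end

lemma domain_mpol_ring: "domain (mpol_ring V :: ('v::linorder, 'k::idom) mpol ring)"
  by (rule domain.intro[OF cring_mpol_ring], unfold_locales) (auto simp: mpol_ring_def)

section \<open>Substitutions and coefficients\<close>

lemma mpol_subst_power: "mpol_subst g (p ^ k) = mpol_subst g p ^ k"
  using mpol_subst_const[of g 1]
  by (induction k) (simp_all add: mpol_subst_mult mpol_const_def)

lemma mpol_subst_prod: "mpol_subst g (prod f A) = (\<Prod>x\<in>A. mpol_subst g (f x))"
  using mpol_subst_const[of g 1]
  by (induction A rule: infinite_finite_induct) (simp_all add: mpol_subst_mult mpol_const_def)

lemma mpol_subst_mpol_subst: "mpol_subst g (mpol_subst f p) = mpol_subst (\<lambda>x. mpol_subst g (f x)) p"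
  unfolding mpol_subst_def[of f p] mpol_subst_def[of "\<lambda>x. mpol_subst g (f x)" p]
  by (simp add: mpol_subst_sum mpol_subst_mult mpol_subst_const mpol_subst_prod mpol_subst_power)

lemma mpol_subst_0:
  fixes p :: "('v, 'k::comm_ring_1) mpol"
  shows "mpol_subst (\<lambda>_. 0 :: ('w, 'k) mpol) p = mpol_const (Poly_Mapping.lookup p 0)"
proof -
  have "mpol_const (Poly_Mapping.lookup p t) * (\<Prod>x\<in>Poly_Mapping.keys t. 0 ^ Poly_Mapping.lookup t x)
      = (if t = 0 then mpol_const (Poly_Mapping.lookup p 0) else (0 :: ('w, 'k) mpol))" for t
  proof (cases "t = 0")
    case False
    then obtain x where "x \<in> Poly_Mapping.keys t"
      by (metis all_not_in_conv keys_eq_empty)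
    then have "(\<Prod>x\<in>Poly_Mapping.keys t. 0 ^ Poly_Mapping.lookup t x) = (0 :: ('w, 'k) mpol)"
      by (intro prod_zero) (auto intro!: bexI[of _ x] simp: in_keys_iff zero_power)
    then show ?thesis using False by simp
  qed simp
  then show ?thesis
    by (simp add: mpol_subst_def in_keys_iff mpol_const_def)
qed

lemma mpol_const_eq_0_iff: "mpol_const c = 0 \<longleftrightarrow> c = 0"
  unfolding mpol_const_def by (metis lookup_single_eq lookup_zero single_zero)

lemma mpol_var_neq_0: "mpol_var x \<noteq> 0"
  unfolding mpol_var_def by (metis lookup_single_eq lookup_zero zero_neq_one)

lemma mpol_var_power: "mpol_var x ^ k = Poly_Mapping.single (Poly_Mapping.single x k) 1"
  by (induction k) (simp_all add: mpol_var_def mult_single single_add[symmetric])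

lemma lookup_times_const:
  fixes p :: "('a::comm_monoid_add \<Rightarrow>\<^sub>0 'k::comm_semiring_1)"
  shows "Poly_Mapping.lookup (p * Poly_Mapping.single 0 c) t = Poly_Mapping.lookup p t * c"
proof -
  have "p * Poly_Mapping.single 0 c =
      (\<Sum>r\<in>Poly_Mapping.keys p. Poly_Mapping.single r (Poly_Mapping.lookup p r * c))"
    by (subst mpol_sum_single[of p]) (simp add: sum_distrib_right mult_single)
  then show ?thesis
    by (cases "t \<in> Poly_Mapping.keys p") (auto simp: lookup_sum lookup_single when_def in_keys_iff)
qed

text \<open>Addition of \<open>s\<close> is cancellative, so no two shifted terms collide.\<close>

lemma lookup_times_single:
  fixes p :: "('a::cancel_comm_monoid_add \<Rightarrow>\<^sub>0 'k::comm_semiring_1)"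
  shows "Poly_Mapping.lookup (p * Poly_Mapping.single s 1) (t + s) = Poly_Mapping.lookup p t"
proof -
  have "p * Poly_Mapping.single s 1 =
      (\<Sum>r\<in>Poly_Mapping.keys p. Poly_Mapping.single (r + s) (Poly_Mapping.lookup p r))"
    by (subst mpol_sum_single[of p]) (simp add: sum_distrib_right mult_single)
  then show ?thesis
    by (cases "t \<in> Poly_Mapping.keys p") (auto simp: lookup_sum lookup_single when_def in_keys_iff)
qed

lemma keys_times_single:
  fixes p :: "('a::comm_monoid_add \<Rightarrow>\<^sub>0 'k::comm_ring_1)"
  shows "Poly_Mapping.keys (p * Poly_Mapping.single s 1) \<subseteq> (\<lambda>t. t + s) ` Poly_Mapping.keys p"
  using keys_mult[of p "Poly_Mapping.single s 1"] by fastforce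

lemma monomial_param_eq_single:
  "monomial_param n m i = Poly_Mapping.single (curve_exponent n m i) (1 :: 'k::comm_ring_1)"
  by (simp add: monomial_param_def curve_exponent_def mpol_var_power mult_single)

text \<open>The right side is closed under sums and products and contains constants and images of
  variables. Conversely, induction over the semigroup reaches each monomial, and sums of these give
  the rest.\<close>

lemma image_mpol_subst_monomial_param:
  "mpol_subst (monomial_param n m) ` carrier (mpol_ring {1..n + 1}) =
    {p :: (param, 'k::comm_ring_1) mpol. Poly_Mapping.keys p \<subseteq> curve_semigroup n m}"
  (is "?h ` carrier ?R = ?A")
proof
  have A_sum: "sum f I \<in> ?A" if "\<And>x. x \<in> I \<Longrightarrow> f x \<in> ?A" for f :: "'c \<Rightarrow> (param, 'k) mpol" and I
    using that Poly_Mapping.keys_sum[of f I] by fastforce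
  have A_mult: "p * q \<in> ?A" if "p \<in> ?A" "q \<in> ?A" for p q :: "(param, 'k) mpol"
    using that keys_mult[of p q] curve_semigroup_add by (fastforce simp: subset_iff)
  have A_const: "mpol_const c \<in> ?A" for c :: 'k
    by (simp add: mpol_const_def curve_semigroup.zero)
  then have A_1: "1 \<in> ?A"
    by (simp add: curve_semigroup.zero)
  have A_power: "p ^ k \<in> ?A" if "p \<in> ?A" for p :: "(param, 'k) mpol" and k
    using that A_mult A_1 by (induction k) auto
  have A_prod: "prod f I \<in> ?A" if "\<And>x. x \<in> I \<Longrightarrow> f x \<in> ?A" for f :: "nat \<Rightarrow> (param, 'k) mpol" and I
    using that A_mult A_1 by (induction I rule: infinite_finite_induct) auto
  show "?h ` carrier ?R \<subseteq> ?A"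
  proof (rule image_subsetI)
    fix p :: "(nat, 'k) mpol" assume p: "p \<in> carrier ?R"
    show "?h p \<in> ?A"
      unfolding mpol_subst_def
    proof (intro A_sum A_mult A_const A_prod A_power)
      fix t x assume "t \<in> Poly_Mapping.keys p" "x \<in> Poly_Mapping.keys t"
      then have "x \<in> {1..n + 1}"
        using p by (auto simp: mpol_ring_def simp del: atLeastAtMost_iff)
      then show "monomial_param n m x \<in> ?A"
        by (simp add: monomial_param_eq_single curve_semigroup_generator del: atLeastAtMost_iff)
    qed
  qed
  interpret h: ring_hom_ring ?R "mpol_ring UNIV" ?h
    by (rule mpol_subst_ring_hom_ring)
  have mono: "Poly_Mapping.single s c \<in> ?h ` carrier ?R" if "s \<in> curve_semigroup n m" for s and c :: 'k
    using that
  proof induction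
    case zero
    have "mpol_const c \<in> carrier ?R"
      by (simp add: mpol_const_def mpol_ring_def)
    then show ?case
      using mpol_subst_const[of "monomial_param n m" c] by (intro image_eqI[of _ _ "mpol_const c"]) (auto simp: mpol_const_def)
  next
    case (add_generator s i)
    then obtain q where q: "q \<in> carrier ?R" "Poly_Mapping.single s c = ?h q"
      by blast
    have x: "mpol_var i \<in> carrier ?R"
      using add_generator by (simp add: mpol_var_def mpol_ring_def)
    have "q * mpol_var i \<in> carrier ?R"
      using h.R.m_closed[OF q(1) x] by (simp add: mpol_ring_def)
    moreover have "?h (q * mpol_var i) = Poly_Mapping.single (s + curve_exponent n m i) c"
      using q(2)[symmetric] by (simp add: mpol_subst_mult mpol_subst_var monomial_param_eq_single mult_single)
    ultimately show ?case
      by (metis image_eqI)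
  qed
  have sums: "(\<Sum>s\<in>K. Poly_Mapping.single s (f s)) \<in> ?h ` carrier ?R"
    if "finite K" "K \<subseteq> curve_semigroup n m" for f :: "_ \<Rightarrow> 'k" and K
    using that
  proof (induction K rule: finite_induct)
    case empty
    then show ?case
      using h.R.zero_closed by (auto simp: mpol_ring_def intro!: image_eqI[of _ _ 0])
  next
    case (insert s K)
    then obtain q r where "q \<in> carrier ?R" "Poly_Mapping.single s (f s) = ?h q"
      "r \<in> carrier ?R" "(\<Sum>s\<in>K. Poly_Mapping.single s (f s)) = ?h r"
      using mono[of s "f s"] by blast
    then show ?case
      using insert h.R.a_closed[of q r]
      by (auto simp: mpol_ring_def mpol_subst_add intro!: image_eqI[of _ _ "q + r"])
  qed
  show "?A \<subseteq> ?h ` carrier ?R"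
  proof
    fix p assume "p \<in> ?A"
    then show "p \<in> ?h ` carrier ?R"
      using sums[of "Poly_Mapping.keys p" "Poly_Mapping.lookup p"] by (subst mpol_sum_single) simp
  qed
qed

text \<open>The first isomorphism theorem, phrased as an embedding so that later computations take
  place in polynomials in u and v instead of cosets.\<close>

lemma coordinate_ring_embedding:
  obtains \<psi> :: "(nat, 'k::comm_ring_1) mpol set \<Rightarrow> (param, 'k) mpol"
  where "ring_hom_ring (coordinate_ring n m) (mpol_ring UNIV) \<psi>"
    "inj_on \<psi> (carrier (coordinate_ring n m))"
    "\<psi> ` carrier (coordinate_ring n m) = {p. Poly_Mapping.keys p \<subseteq> curve_semigroup n m}"
proof -
  let ?h = "mpol_subst (monomial_param n m) :: (nat, 'k) mpol \<Rightarrow> (param, 'k) mpol"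
  interpret h: ring_hom_ring "mpol_ring {1..n + 1}" "mpol_ring UNIV" ?h
    by (rule mpol_subst_ring_hom_ring)
  have R: "coordinate_ring n m = mpol_ring {1..n + 1} Quot a_kernel (mpol_ring {1..n + 1}) (mpol_ring UNIV) ?h"
    by (simp add: coordinate_ring_def vanishing_ideal_def)
  show thesis
  proof
    show "ring_hom_ring (coordinate_ring n m) (mpol_ring UNIV) (\<lambda>X. the_elem (?h ` X))"
      using h.the_elem_hom unfolding R
      by (intro ring_hom_ringI2 ideal.quotient_is_ring[OF h.kernel_is_ideal] h.S.ring_axioms)
    show "inj_on (\<lambda>X. the_elem (?h ` X)) (carrier (coordinate_ring n m))"
      unfolding R by (rule inj_onI) (rule h.the_elem_inj)
    show "(\<lambda>X. the_elem (?h ` X)) ` carrier (coordinate_ring n m) = {p. Poly_Mapping.keys p \<subseteq> curve_semigroup n m}"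
      unfolding R h.the_elem_surj by (rule image_mpol_subst_monomial_param)
  qed
qed

section \<open>Failure of the Cohen--Macaulay property\<close>

theorem theorem3p1:
  fixes m i :: "nat \<Rightarrow> nat" and n l h d :: nat
  assumes "infinite (UNIV :: 'k::field set)"
    and "\<And>j. j \<in> {1..n} \<Longrightarrow> m j > 0"
    and "strict_mono_on {1..n} m"
    and "l \<ge> 3"
    and "strict_mono_on {1..l} i"
    and "i 1 \<ge> 1"
    and "i l = n"
    and "h > 0"
    and "d > 0"
    and "\<And>j. j \<in> {2..l} \<Longrightarrow> m (i j) = h * m (i 1) + (j - 1) * d"
    and "h > 1"
    and "h * m (i 1) \<notin> m ` {1..n}"
  shows "\<not> cohen_macaulay (coordinate_ring n m :: (nat, 'k) mpol set ring)"
proof -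
  interpret gap: arithmetic_gap n l h d m i
    by unfold_locales (use assms in auto)
  let ?K = "mpol_ring UNIV :: (param, 'k) mpol ring"
  define R where "R = (coordinate_ring n m :: (nat, 'k) mpol set ring)"
  define S where "S = curve_semigroup n m"
  obtain \<psi> where \<psi>: "ring_hom_ring R ?K \<psi>" and inj: "inj_on \<psi> (carrier R)"
    and img: "\<psi> ` carrier R = {p. Poly_Mapping.keys p \<subseteq> S}"
    unfolding R_def S_def by (rule coordinate_ring_embedding)
  interpret K: domain ?K
    by (rule domain_mpol_ring)
  interpret R: cring R
    unfolding R_def by (rule cring_coordinate_ring)
  interpret \<psi>: ring_hom_ring R ?K \<psi>
    by (rule \<psi>)
  interpret R: domain R
    by (rule \<psi>.inj_on_domain[OF inj K.domain_axioms])
  have K_simps: "x \<otimes>\<^bsub>?K\<^esub> y = x * y" "x \<oplus>\<^bsub>?K\<^esub> y = x + y" "\<one>\<^bsub>?K\<^esub> = 1" "\<zero>\<^bsub>?K\<^esub> = 0" for x y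
    by (simp_all add: mpol_ring_def)
  have hom: "\<psi> (x \<otimes>\<^bsub>R\<^esub> y) = \<psi> x * \<psi> y" "\<psi> (x \<oplus>\<^bsub>R\<^esub> y) = \<psi> x + \<psi> y"
    if "x \<in> carrier R" "y \<in> carrier R" for x y
    using that by (simp_all add: K_simps)
  have hom_1: "\<psi> \<one>\<^bsub>R\<^esub> = 1" and hom_0: "\<psi> \<zero>\<^bsub>R\<^esub> = 0"
    by (simp_all add: K_simps)
  have lift: "\<exists>r \<in> carrier R. \<psi> r = p" if "Poly_Mapping.keys p \<subseteq> S" for p
    using that img by (metis (no_types, lifting) image_iff mem_Collect_eq)
  have keys: "Poly_Mapping.keys (\<psi> r) \<subseteq> S" if "r \<in> carrier R" for r
    using that img by blast
  have S0: "0 \<in> S"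
    by (simp add: S_def curve_semigroup.zero)
  have S_gen: "curve_exponent n m j \<in> S" if "j \<in> {1..n + 1}" for j
    using curve_semigroup_generator[OF that] by (simp add: S_def)
  have m_n: "m n > 0"
    using gap.n_pos assms(2) by blast

  \<comment> \<open>Each \<open>Q g\<close> is the kernel of a map into a domain, hence prime.
    Below, \<open>g\<close> is the identity, then u is set to 0, then both parameters are.\<close>
  define Q where "Q g = {r \<in> carrier R. mpol_subst g (\<psi> r) = 0}" for g :: "param \<Rightarrow> (param, 'k) mpol"
  define g\<^sub>u where "g\<^sub>u = (\<lambda>x. if x = Param_u then 0 else mpol_var x :: (param, 'k) mpol)"
  define M where "M = Q (\<lambda>_. 0)"
  have Q_prime: "primeideal (Q g) R" for g
  proof -
    interpret g: ring_hom_ring ?K ?K "mpol_subst g"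
      by (rule mpol_subst_ring_hom_ring)
    have "ring_hom_ring R ?K (mpol_subst g \<circ> \<psi>)"
      by (rule ring_hom_ringI2) (auto intro: ring_hom_trans[OF \<psi>.homh g.homh] R.ring_axioms K.ring_axioms)
    from ring_hom_ring.primeideal_vimage[OF this R.is_cring K.zeroprimeideal]
    show ?thesis
      by (simp add: Q_def K_simps)
  qed
  have M_iff: "r \<in> M \<longleftrightarrow> r \<in> carrier R \<and> Poly_Mapping.lookup (\<psi> r) 0 = 0" for r
    by (simp add: M_def Q_def mpol_subst_0 mpol_const_eq_0_iff)
  interpret R: domain_with_prime R M
    unfolding M_def by (intro domain_with_prime.intro domain_with_prime_axioms.intro R.domain_axioms Q_prime)

  have "maximalideal M R"
  proof (rule maximalidealI)
    show "ideal M R"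
      using R.prime_M by (rule primeideal.axioms)
    show "carrier R \<noteq> M"
      using primeideal.I_notcarr[OF R.prime_M] .
    fix J
    assume J: "ideal J R" "M \<subseteq> J" "J \<subseteq> carrier R"
    interpret J: ideal J R by fact
    show "J = M \<or> J = carrier R"
    proof (cases "J = M")
      case False
      then obtain r where r: "r \<in> J" "r \<in> carrier R" "Poly_Mapping.lookup (\<psi> r) 0 \<noteq> 0"
        using J M_iff by blast
      \<comment> \<open>The constant \<open>?c\<close> scales the constant term of \<open>r\<close>
        to 1, so \<open>1 - r q\<close> has none and falls into \<open>M\<close>.\<close>
      let ?c = "inverse (Poly_Mapping.lookup (\<psi> r) 0)"
      obtain q where q: "q \<in> carrier R" "\<psi> q = Poly_Mapping.single 0 ?c"
        using lift[of "Poly_Mapping.single 0 ?c"] S0 r(3) by auto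
      obtain y where y: "y \<in> carrier R" "\<psi> y = 1 - \<psi> (r \<otimes>\<^bsub>R\<^esub> q)"
      proof -
        have "Poly_Mapping.keys (1 - \<psi> (r \<otimes>\<^bsub>R\<^esub> q)) \<subseteq> S"
          using keys_diff[of 1 "\<psi> (r \<otimes>\<^bsub>R\<^esub> q)"] S0 keys[OF R.m_closed[OF r(2) q(1)]] by auto
        from lift[OF this] that show thesis
          by blast
      qed
      have "Poly_Mapping.lookup (\<psi> (r \<otimes>\<^bsub>R\<^esub> q)) 0 = 1"
        using r q by (simp add: hom(1) lookup_times_const del: \<psi>.hom_mult)
      then have "y \<in> M"
        using y by (simp add: M_iff lookup_minus)
      moreover have "y \<oplus>\<^bsub>R\<^esub> (r \<otimes>\<^bsub>R\<^esub> q) = \<one>\<^bsub>R\<^esub>"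
        by (rule inj_onD[OF inj]) (use y r q in \<open>auto simp: hom hom_1 simp del: \<psi>.hom_mult \<psi>.hom_add \<psi>.hom_one\<close>)
      ultimately have "\<one>\<^bsub>R\<^esub> \<in> J"
        using J.a_closed[of y "r \<otimes>\<^bsub>R\<^esub> q"] J.I_r_closed[OF r(1) q(1)] J(2) by auto
      then show ?thesis
        using J.one_imp_carrier by blast
    qed simp
  qed

  have "enat 2 \<le> krull_dim R.Loc"
  proof -
    have "mpol_subst (\<lambda>_. 0) (g\<^sub>u x) = (0 :: (param, 'k) mpol)" for x
      by (simp add: g\<^sub>u_def mpol_subst_var)
    \<comment> \<open>Each substitution of the chain factors through the preceding one, so the
      kernels increase.\<close>
    then have comp: "mpol_subst (\<lambda>_. 0) (mpol_subst g\<^sub>u p) = (mpol_subst (\<lambda>_. 0) p :: (param, 'k) mpol)"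
      "mpol_subst g\<^sub>u (mpol_subst mpol_var p) = mpol_subst g\<^sub>u p" for p
      by (simp_all add: mpol_subst_mpol_subst mpol_subst_var)
    let ?Qs = "[Q mpol_var, Q g\<^sub>u, M]"
    \<comment> \<open>The pure powers of u and v witness that the two inclusions are strict.\<close>
    obtain x y where x: "x \<in> carrier R" "\<psi> x = Poly_Mapping.single (Poly_Mapping.single Param_u (m n)) 1"
      and y: "y \<in> carrier R" "\<psi> y = Poly_Mapping.single (Poly_Mapping.single Param_v (m n)) 1"
      using lift[of "Poly_Mapping.single (Poly_Mapping.single Param_u (m n)) 1"]
        lift[of "Poly_Mapping.single (Poly_Mapping.single Param_v (m n)) 1"]
        S_gen[of n] S_gen[of "n + 1"] gap.n_pos unfolding gap.a_n gap.a_Suc_n by auto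
    have "r \<in> Q g\<^sub>u" if "r \<in> Q mpol_var" for r
      using that comp(2)[of "\<psi> r"] by (simp add: Q_def)
    moreover have "r \<in> M" if "r \<in> Q g\<^sub>u" for r
      using that comp(1)[of "\<psi> r"] by (simp add: Q_def M_def)
    moreover have "x \<in> Q g\<^sub>u" "x \<notin> Q mpol_var" "y \<in> M" "y \<notin> Q g\<^sub>u"
      using x y m_n by (simp_all add: Q_def M_def mpol_subst_single g\<^sub>u_def mpol_const_eq_0_iff mpol_var_neq_0)
    ultimately show ?thesis
      by (intro R.krull_dim_Loc_ge[of ?Qs]) (auto simp: Q_prime R.prime_M)
  qed

  moreover have "local_depth R.Loc \<le> 1"
  proof -
    obtain s where s: "s \<notin> S" "\<And>j. j \<in> {1..n + 1} \<Longrightarrow> s + curve_exponent n m j \<in> S"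
      using gap.ex_socle_exponent unfolding S_def by blast
    let ?s = "Poly_Mapping.single s (1 :: 'k)"
    let ?a = "Poly_Mapping.single (curve_exponent n m n) (1 :: 'k)"
    have a_s: "?s * ?a = Poly_Mapping.single (s + curve_exponent n m n) 1"
      by (simp add: mult_single)
    \<comment> \<open>The fraction \<open>b / f\<close> is the monomial with exponent
      \<open>s\<close>, which is missing from the ring; multiplying by \<open>?a\<close> brings it
      into the ring.\<close>
    obtain f b where f: "f \<in> carrier R" "\<psi> f = ?a" and b: "b \<in> carrier R" "\<psi> b = ?s * ?a"
      using lift[of ?a] lift[of "?s * ?a"] S_gen[of n] s(2)[of n] gap.n_pos unfolding a_s by auto
    show ?thesis
    proof (rule R.local_depth_Loc_le_1[OF f(1) _ b(1)])
      show "f \<noteq> \<zero>\<^bsub>R\<^esub>"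
        using f(2) hom_0 by (metis lookup_single_eq lookup_zero zero_neq_one)
      have eq: "r \<otimes>\<^bsub>R\<^esub> b = f \<otimes>\<^bsub>R\<^esub> r' \<longleftrightarrow> \<psi> r * ?s = \<psi> r'"
        if "r \<in> carrier R" "r' \<in> carrier R" for r r'
      proof -
        have "r \<otimes>\<^bsub>R\<^esub> b = f \<otimes>\<^bsub>R\<^esub> r' \<longleftrightarrow> \<psi> (r \<otimes>\<^bsub>R\<^esub> b) = \<psi> (f \<otimes>\<^bsub>R\<^esub> r')"
          using that f(1) b(1) by (intro inj_on_eq_iff[OF inj, symmetric] R.m_closed)
        also have "\<dots> \<longleftrightarrow> ?a * (\<psi> r * ?s) = ?a * \<psi> r'"
          unfolding hom(1)[OF that(1) b(1)] hom(1)[OF f(1) that(2)] f(2) b(2) by (simp only: mult_ac)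
        also have "\<dots> \<longleftrightarrow> \<psi> r * ?s = \<psi> r'"
          by (rule mult_left_cancel) (metis lookup_single_eq lookup_zero zero_neq_one)
        finally show ?thesis .
      qed
      have "r \<in> M \<longleftrightarrow> r \<in> carrier R \<and> (\<exists>r'\<in>carrier R. r \<otimes>\<^bsub>R\<^esub> b = f \<otimes>\<^bsub>R\<^esub> r')" for r
      proof (cases "r \<in> carrier R")
        case True
        have "(\<exists>r'\<in>carrier R. r \<otimes>\<^bsub>R\<^esub> b = f \<otimes>\<^bsub>R\<^esub> r') \<longleftrightarrow> Poly_Mapping.keys (\<psi> r * ?s) \<subseteq> S"
          using eq[OF True] lift[of "\<psi> r * ?s"] keys by metis
        also have "\<dots> \<longleftrightarrow> Poly_Mapping.lookup (\<psi> r) 0 = 0"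
        proof
          \<comment> \<open>The constant term of \<open>\<psi> r\<close> is the coefficient of the
            product at \<open>s\<close>, which is outside \<open>S\<close>.\<close>
          assume "Poly_Mapping.keys (\<psi> r * ?s) \<subseteq> S"
          then have "s \<notin> Poly_Mapping.keys (\<psi> r * ?s)"
            using s(1) by blast
          then show "Poly_Mapping.lookup (\<psi> r) 0 = 0"
            using lookup_times_single[of "\<psi> r" s 0] by (simp add: in_keys_iff)
        next
          assume 0: "Poly_Mapping.lookup (\<psi> r) 0 = 0"
          have "t + s \<in> S" if "t \<in> Poly_Mapping.keys (\<psi> r)" for t
          proof -
            have "t \<in> curve_semigroup n m" "t \<noteq> 0"
              using that keys[OF True] 0 by (auto simp: S_def in_keys_iff)
            \<comment> \<open>A nonzero exponent ends in a generator, and that generator moves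
              \<open>s\<close> into \<open>S\<close>.\<close>
            then obtain t' j where t: "t = t' + curve_exponent n m j" "t' \<in> S" "j \<in> {1..n + 1}"
              by (cases rule: curve_semigroup.cases) (auto simp: S_def)
            have "t' + (s + curve_exponent n m j) \<in> S"
              using t s(2) curve_semigroup_add unfolding S_def by blast
            then show ?thesis
              unfolding t(1) by (simp add: add_ac)
          qed
          then show "Poly_Mapping.keys (\<psi> r * ?s) \<subseteq> S"
            using keys_times_single[of "\<psi> r" s] by blast
        qed
        finally show ?thesis
          using True M_iff by blast
      qed (simp add: M_iff)
      then show "M = {r \<in> carrier R. \<exists>r'\<in>carrier R. r \<otimes>\<^bsub>R\<^esub> b = f \<otimes>\<^bsub>R\<^esub> r'}"
        by blast
    qed
  qed
  ultimately have "local_depth R.Loc \<noteq> krull_dim R.Loc"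
    by (metis enat_ord_simps(1) one_enat_def order_trans not_less_eq_eq numeral_2_eq_2 One_nat_def order_refl)
  with \<open>maximalideal M R\<close> show ?thesis
    unfolding cohen_macaulay_def R_def by blast
qed

end
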